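(* Let $k \geq 1$ be a fixed integer and $R$ a fixed finite abelian group, and let $\omega(n)$ be any function with $\omega(n) \to \infty$ as $n\to\infty$. For $Y$ drawn from $Y_k(n,p)$, $$\lim_{n \to \infty} \Pr\big[\, H^{k-1}(Y;R)=0 \,\big]= \begin{cases} 0 & \text{if } p=\frac{k\log n -\omega(n)}{n}, \\ 1 & \text{if } p=\frac{k\log n+ \omega(n)}{n}. \end{cases}$$
   Context: $\log$ is the natural logarithm. $\Delta_{n-1}$ is the $(n-1)$-dimensional simplex on vertex set $[n]=\{1,\dots,n\}$; for a simplicial complex $X$, $X^{(k)}$ is its $k$-skeleton (all faces of dimension $\le k$) and $f_k(X)$ is the number of $k$-dimensional faces of $X$. $Y_k(n,p)$ is the probability space of all complexes $Y$ with $\Delta_{n-1}^{(k-1)} \subset Y \subset \Delta_{n-1}^{(k)}$, with $\Pr(Y)=p^{f_k(Y)}(1-p)^{\binom{n}{k+1}-f_k(Y)}$ (i.e. start from the full $(k-1)$-skeleton and add each $k$-simplex independently with probability $p$). For a complex $X$ on vertex set $V$, a $j$-cochain ($j\ge 0$) is an $R$-valued function on ordered $j$-simplices of $X$ that is skew-symmetric under permutation of the vertices; $C^j(X)$ is the group of $j$-cochains, with coboundary $d_j\phi([v_0,\dots,v_{j+1}])=\sum_{i=0}^{j+1}(-1)^i\phi([v_0,\dots,\widehat{v_i},\dots,v_{j+1}])$. The complex is augmented by $C^{-1}(X)=R$ with $d_{-1}a(v)=a$ for all $a\in R$, $v\in V$. $H^{j}(X;R)=\ker d_j/\operatorname{Im}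 d_{j-1}$ is the $j$-th reduced cohomology group with coefficients in $R$.
   Formalization: The group R is assumed nontrivial (for R = 0 the cohomology always vanishes, so the first limit would be 1, not 0), and in each case p is assumed to lie in [0,1] for all large n, so that Y_k(n,p) is defined. *)

theory Defs
  imports Complex_Main "HOL-Combinatorics.Permutations"
begin

text \<open>Vertex set [n] = {1..n}.  A complex Y in Y_k(n,p) is determined by its set S of
  k-dimensional faces, i.e. a set of (k+1)-element subsets of [n]; all faces of
  dimension < k are present.\<close>

definition ksimplices :: "nat \<Rightarrow> nat \<Rightarrow> nat set set" where
  "ksimplices n k = {\<sigma>. \<sigma> \<subseteq> {1..n} \<and> card \<sigma> = k + 1}"

text \<open>Ordered faces of Y with m vertices (an ordered (m-1)-simplex), as lists of distinct
  vertices.  For m = 0 this is just the empty list, so functions on it are elements of R: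
  this realises the augmentation C^{-1}(Y) = R, and the coboundary below applied to such a
  function gives d_{-1} a (v) = a.\<close>

definition ofaces :: "nat \<Rightarrow> nat \<Rightarrow> nat set set \<Rightarrow> nat \<Rightarrow> nat list set" where
  "ofaces n k S m = {xs. length xs = m \<and> distinct xs \<and> set xs \<subseteq> {1..n} \<and>
                         (m \<le> k \<or> (m = k + 1 \<and> set xs \<in> S))}"

definition is_cochain :: "nat list set \<Rightarrow> nat \<Rightarrow> (nat list \<Rightarrow> 'r::ab_group_add) \<Rightarrow> bool" where
  "is_cochain F m \<phi> \<longleftrightarrow>
     (\<forall>xs\<in>F. \<forall>\<pi>. \<pi> permutes {..<m} \<longrightarrow>
        \<phi> (map (\<lambda>i. xs ! \<pi> i) [0..<m]) = (if evenperm \<pi> then \<phi> xs else - \<phi> xs))"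

definition del_nth :: "nat \<Rightarrow> 'a list \<Rightarrow> 'a list" where
  "del_nth i xs = take i xs @ drop (Suc i) xs"

definition cobdry :: "(nat list \<Rightarrow> 'r::ab_group_add) \<Rightarrow> nat list \<Rightarrow> 'r" where
  "cobdry \<phi> xs = (\<Sum>i<length xs. if even i then \<phi> (del_nth i xs) else - \<phi> (del_nth i xs))"

text \<open>H^{k-1}(Y;R) = 0 (reduced, augmented), for k \<ge> 1: every (k-1)-cocycle is the
  coboundary of a (k-2)-cochain.  (k-1)-cochains live on lists with k vertices.\<close>

definition cohom_vanishes ::
    "'r::ab_group_add itself \<Rightarrow> nat \<Rightarrow> nat \<Rightarrow> nat set set \<Rightarrow> bool" where
  "cohom_vanishes _ n k S \<longleftrightarrow>
     (\<forall>\<phi> :: nat list \<Rightarrow> 'r.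
        is_cochain (ofaces n k S k) k \<phi> \<and> (\<forall>xs\<in>ofaces n k S (k+1). cobdry \<phi> xs = 0)
        \<longrightarrow> (\<exists>\<psi> :: nat list \<Rightarrow> 'r. is_cochain (ofaces n k S (k - 1)) (k - 1) \<psi> \<and>
               (\<forall>xs\<in>ofaces n k S k. cobdry \<psi> xs = \<phi> xs)))"

definition probY :: "nat \<Rightarrow> nat \<Rightarrow> real \<Rightarrow> (nat set set \<Rightarrow> bool) \<Rightarrow> real" where
  "probY n k p Q = (\<Sum>S\<in>{S. S \<subseteq> ksimplices n k \<and> Q S}.
        p ^ card S * (1 - p) ^ (card (ksimplices n k) - card S))"

end

theory Submission
  imports Defs "HOL-Library.FuncSet" "HOL-Library.Cardinality"
begin

text \<open>
  Below the threshold, a second moment computation shows that with high probability some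
  \<open>(k-1)\<close>-simplex lies in no \<open>k\<close>-simplex of \<open>Y\<close>, and such a simplex supports a nontrivial class.

  Above the threshold, one takes a union bound over cochains \<open>\<phi>\<close> whose support is smallest in their
  class; \<open>\<phi>\<close> is a cocycle of \<open>Y\<close> with probability \<open>(1-p)^b\<close>, where \<open>b\<close> is the number of
  \<open>k\<close>-simplices of the full simplex on which \<open>d\<phi>\<close> does not vanish. Let \<open>m\<close> be the size of the support \<open>F\<close>
  of \<open>\<phi>\<close>. Every \<open>k\<close>-simplex with exactly one face in \<open>F\<close> counts towards \<open>b\<close>, so \<open>b\<close> is nearly
  \<open>m n\<close> when \<open>m \<le> sqrt n\<close>, and the trivial count of supports suffices. For larger \<open>m\<close> one has
  \<open>b \<ge> m n / (k+1)\<close>, and if \<open>b\<close> is much smaller than \<open>m n\<close> then most members of \<open>F\<close> have a number of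
  neighbours in \<open>F\<close> linear in \<open>n\<close>. Such members are dominated by a set \<open>S\<close> of \<open>O(m/n)\<close> members of \<open>F\<close>
  and can be encoded by \<open>O(m)\<close> bits, so that \<open>F\<close> is determined by essentially \<open>b/n\<close> free choices of a
  simplex, and the factor \<open>(1-p)^b\<close> beats the number of supports.
\<close>

section \<open>Skew functions and coboundaries\<close>

text \<open>The ordered simplices of the full simplex. Below the top dimension these are the ordered
  faces of every complex of the model, so cochains and their classes can be handled without
  reference to \<open>S\<close>.\<close>

definition olists :: "nat \<Rightarrow> nat \<Rightarrow> nat list set" where
  "olists n m = {xs. length xs = m \<and> distinct xs \<and> set xs \<subseteq> {1..n}}"

text \<open>Antisymmetry is imposed on all lists, not only on faces: this makes it stable under
  coboundaries and under prepending a vertex without side conditions. A cochain given on the faces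
  only is extended by zero (\<open>trunc\<close>).\<close>

definition skew :: "('a list \<Rightarrow> 'r::ab_group_add) \<Rightarrow> bool" where
  "skew \<phi> \<longleftrightarrow> (\<forall>as a b bs. \<phi> (as @ b # a # bs) = - \<phi> (as @ a # b # bs))"

text \<open>Unordered simplices are collected, so that supports can be counted as families of sets;
  for skew functions the choice of ordering does not affect vanishing
  (\<open>mem_support_iff\<close>).\<close>

definition support :: "nat \<Rightarrow> nat \<Rightarrow> (nat list \<Rightarrow> 'r::ab_group_add) \<Rightarrow> nat set set" where
  "support n m \<phi> = set ` {xs \<in> olists n m. \<phi> xs \<noteq> 0}"

definition trunc :: "nat \<Rightarrow> nat \<Rightarrow> (nat list \<Rightarrow> 'r::ab_group_add) \<Rightarrow> nat list \<Rightarrow> 'r" where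
  "trunc n m \<phi> xs = (if xs \<in> olists n m then \<phi> xs else 0)"

lemma ofaces_eq_olists: "m \<le> k \<Longrightarrow> ofaces n k S m = olists n m"
  unfolding ofaces_def olists_def by (intro Collect_cong) blast

lemma ofaces_top: "ofaces n k S (k + 1) = {xs \<in> olists n (k + 1). set xs \<in> S}"
  unfolding ofaces_def olists_def by (intro Collect_cong) simp

lemma skewD: "skew \<phi> \<Longrightarrow> \<phi> (as @ b # a # bs) = - \<phi> (as @ a # b # bs)"
  unfolding skew_def by blast

lemma skew_Cons: "skew \<phi> \<Longrightarrow> skew (\<lambda>xs. \<phi> (x # xs))"
  unfolding skew_def[of "\<lambda>xs. \<phi> (x # xs)"] using skewD[of \<phi> "x # as" for as]
  by (metis append_Cons)

lemma skew_add: "skew \<phi> \<Longrightarrow> skew \<psi> \<Longrightarrow> skew (\<lambda>xs. \<phi> xs + \<psi> xs)"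
  unfolding skew_def[of "\<lambda>xs. \<phi> xs + \<psi> xs"]
  using skewD[of \<phi>] skewD[of \<psi>] by (metis minus_add_distrib)

lemma skew_diff: "skew \<phi> \<Longrightarrow> skew \<psi> \<Longrightarrow> skew (\<lambda>xs. \<phi> xs - \<psi> xs)"
  unfolding skew_def[of "\<lambda>xs. \<phi> xs - \<psi> xs"]
  using skewD[of \<phi>] skewD[of \<psi>] by (metis minus_diff_minus)

lemma skew_trunc: "skew \<phi> \<Longrightarrow> skew (trunc n m \<phi>)"
  unfolding skew_def
proof (intro allI)
  fix as bs and a b :: nat
  assume "\<forall>as a b bs. \<phi> (as @ b # a # bs) = - \<phi> (as @ a # b # bs)"
  then have "\<phi> (as @ b # a # bs) = - \<phi> (as @ a # b # bs)" by blast
  moreover have "as @ b # a # bs \<in> olists n m \<longleftrightarrow> as @ a # b # bs \<in> olists n m"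
    by (auto simp: olists_def)
  ultimately show "trunc n m \<phi> (as @ b # a # bs) = - trunc n m \<phi> (as @ a # b # bs)"
    by (simp add: trunc_def)
qed

text \<open>Distant entries are exchanged through adjacent ones: the first entry \<open>c\<close> of
  the middle part is moved to the left of \<open>b\<close>, the shorter exchange is made, and
  \<open>c\<close> is moved back to the right of \<open>a\<close>. This gives three signs.\<close>

lemma skew_swap: "skew \<phi> \<Longrightarrow> \<phi> (as @ b # ms @ a # bs) = - \<phi> (as @ a # ms @ b # bs)"
proof (induction ms arbitrary: as)
  case Nil
  then show ?case using skewD[of \<phi> as b a bs] by simp
next
  case (Cons c ms)
  have "\<phi> (as @ b # (c # ms) @ a # bs) = - \<phi> (as @ c # b # ms @ a # bs)"
    using skewD[OF Cons.prems, of as b c] by simp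
  also have "\<phi> (as @ c # b # ms @ a # bs) = - \<phi> (as @ c # a # ms @ b # bs)"
    using Cons.IH[OF Cons.prems, of "as @ [c]"] by simp
  also have "\<phi> (as @ c # a # ms @ b # bs) = - \<phi> (as @ a # c # ms @ b # bs)"
    using skewD[OF Cons.prems, of as c a] by simp
  finally show ?case by simp
qed

lemma permute_list_transpose:
  assumes "i < j" "j < length xs"
  shows "permute_list (transpose i j) xs =
    take i xs @ xs ! j # take (j - Suc i) (drop (Suc i) xs) @ xs ! i # drop (Suc j) xs"
    (is "_ = ?r")
proof (rule nth_equalityI)
  show "length (permute_list (transpose i j) xs) = length ?r" using assms by simp
  fix l assume "l < length (permute_list (transpose i j) xs)"
  then show "permute_list (transpose i j) xs ! l = ?r ! l"
    using assms
    by (auto simp: permute_list_def nth_append nth_Cons' transpose_def min_def)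
qed

lemma skew_transpose:
  assumes "skew \<phi>" "i < length xs" "j < length xs" "i \<noteq> j"
  shows "\<phi> (permute_list (transpose i j) xs) = - \<phi> xs"
  using assms
proof (induction i j rule: linorder_wlog)
  case (le i j)
  have d: "drop (Suc i) xs = take (j - Suc i) (drop (Suc i) xs) @ xs ! j # drop (Suc j) xs"
    using le by (metis Cons_nth_drop_Suc Suc_leI append_take_drop_id drop_drop le_add_diff_inverse2
        le_neq_implies_less)
  have "xs = take i xs @ xs ! i # take (j - Suc i) (drop (Suc i) xs) @ xs ! j # drop (Suc j) xs"
    using le d by (metis id_take_nth_drop)
  then show ?case
    using le skew_swap[OF le(2), of "take i xs" "xs ! j" "take (j - Suc i) (drop (Suc i) xs)" "xs ! i" "drop (Suc j) xs"]
    by (simp add: permute_list_transpose)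
next
  case (sym i j)
  then show ?case by (simp add: transpose_commute)
qed

text \<open>Permutations are built from transpositions, each of which flips both the parity and the
  sign of the value.\<close>

lemma skew_permute:
  assumes "skew \<phi>" "\<pi> permutes {..<m}" "length xs = m"
  shows "\<phi> (permute_list \<pi> xs) = (if evenperm \<pi> then \<phi> xs else - \<phi> xs)"
  using assms(2) finite_lessThan assms(3)
proof (induction arbitrary: xs rule: permutes_induct)
  case id
  then show ?case by simp
next
  case (swap a b p)
  have pp: "permutation p" using swap(4) by (auto simp: permutation_permutes)
  have "permute_list (transpose a b \<circ> p) xs = permute_list p (permute_list (transpose a b) xs)"
    using swap by (intro permute_list_compose) auto
  moreover have "evenperm (transpose a b \<circ> p) \<longleftrightarrow> \<not> evenperm p"
    using swap(3) evenperm_comp[OF permutation_swap_id pp] by (auto simp only: evenperm_swap)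
  ultimately show ?case
    using swap(1-3,6) swap(5)[of "permute_list (transpose a b) xs"] skew_transpose[OF assms(1), of a xs b]
    by (auto simp only: length_permute_list lessThan_iff if_True if_False not_not minus_minus split: if_splits)
qed

lemma skew_imp_is_cochain:
  assumes "skew \<phi>" "\<And>xs. xs \<in> F \<Longrightarrow> length xs = m"
  shows "is_cochain F m \<phi>"
  unfolding is_cochain_def
  using skew_permute[OF assms(1)] assms(2) by (auto simp: permute_list_def)

text \<open>An adjacent swap is an odd permutation, and membership in \<open>olists n m\<close> does
  not depend on the order of entries, so off the faces both sides are zero.\<close>

lemma is_cochain_imp_skew_trunc:
  assumes "is_cochain (olists n m) m \<phi>"
  shows "skew (trunc n m \<phi>)"
  unfolding skew_def
proof (intro allI)
  fix as bs and a b :: nat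
  show "trunc n m \<phi> (as @ b # a # bs) = - trunc n m \<phi> (as @ a # b # bs)"
  proof (cases "as @ a # b # bs \<in> olists n m")
    case True
    let ?i = "length as"
    have sw: "permute_list (transpose ?i (Suc ?i)) (as @ a # b # bs) = as @ b # a # bs"
      by (subst permute_list_transpose) (auto simp: nth_append)
    have m: "m = length (as @ a # b # bs)" using True by (simp add: olists_def)
    have "transpose ?i (Suc ?i) permutes {..<m}"
      using m by (intro permutes_swap_id) auto
    then have "\<phi> (as @ b # a # bs) = - \<phi> (as @ a # b # bs)"
      using assms True sw m unfolding is_cochain_def permute_list_def
      by (metis evenperm_swap n_not_Suc_n)
    then show ?thesis using True by (auto simp: trunc_def olists_def)
  next
    case False
    then show ?thesis by (auto simp: trunc_def olists_def)
  qed
qed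

section \<open>Recursive algebra of coboundaries\<close>

lemma cobdry_Nil [simp]: "cobdry \<phi> [] = 0"
  by (simp add: cobdry_def)

text \<open>Deleting the head is the first term; every other deletion moves one position down and so
  changes sign. This recursion replaces index computations below.\<close>

lemma cobdry_Cons: "cobdry \<phi> (x # xs) = \<phi> xs - cobdry (\<lambda>ys. \<phi> (x # ys)) xs"
  unfolding cobdry_def
  by (simp del: sum.lessThan_Suc add: sum.lessThan_Suc_shift del_nth_def sum_negf[symmetric] if_distrib cong: if_cong)
    (intro sum.cong, auto)

lemma cobdry_cong:
  "(\<And>i. i < length xs \<Longrightarrow> \<phi> (del_nth i xs) = \<psi> (del_nth i xs)) \<Longrightarrow> cobdry \<phi> xs = cobdry \<psi> xs"
  unfolding cobdry_def by (intro sum.cong) auto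

lemma cobdry_eq_0: "(\<And>i. i < length xs \<Longrightarrow> \<phi> (del_nth i xs) = 0) \<Longrightarrow> cobdry \<phi> xs = 0"
  unfolding cobdry_def by (intro sum.neutral) auto

lemma cobdry_add: "cobdry (\<lambda>ys. \<phi> ys + \<psi> ys) xs = cobdry \<phi> xs + cobdry \<psi> xs"
  by (induction xs arbitrary: \<phi> \<psi>) (simp_all add: cobdry_Cons)

lemma cobdry_diff: "cobdry (\<lambda>ys. \<phi> ys - \<psi> ys) xs = cobdry \<phi> xs - cobdry \<psi> xs"
  by (induction xs arbitrary: \<phi> \<psi>) (simp_all add: cobdry_Cons)

lemma cobdry_minus: "cobdry (\<lambda>ys. - \<phi> ys) xs = - cobdry \<phi> xs"
  by (induction xs arbitrary: \<phi>) (simp_all add: cobdry_Cons)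

text \<open>Two unfoldings of \<open>cobdry_Cons\<close> produce two copies of
  \<open>cobdry \<phi> xs\<close> that cancel; what is left is the induction hypothesis for
  \<open>\<phi>\<close> with \<open>x\<close> prepended.\<close>

lemma cobdry_cobdry: "cobdry (cobdry \<phi>) xs = 0"
  by (induction xs arbitrary: \<phi>) (simp_all add: cobdry_Cons cobdry_diff)

text \<open>For a swap at the front the sign is visible after unfolding twice; a swap further back
  is handled by splitting off the head, since prepending a vertex preserves skewness.\<close>

lemma skew_cobdry:
  assumes "skew \<phi>"
  shows "skew (cobdry \<phi>)"
  unfolding skew_def
proof (intro allI)
  fix as bs and a b
  show "cobdry \<phi> (as @ b # a # bs) = - cobdry \<phi> (as @ a # b # bs)"
    using assms
  proof (induction as arbitrary: \<phi>)
    case Nil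
    have "\<phi> (b # a # ys) = - \<phi> (a # b # ys)" for ys
      using skewD[OF Nil, of "[]" b a ys] by simp
    then show ?case by (simp add: cobdry_Cons cobdry_minus)
  next
    case (Cons c as)
    show ?case
      using Cons.IH[OF skew_Cons[OF Cons.prems, of c]] skewD[OF Cons.prems, of as b a bs]
      by (simp add: cobdry_Cons)
  qed
qed

lemma del_nth_olists: "xs \<in> olists n (Suc m) \<Longrightarrow> i < length xs \<Longrightarrow> del_nth i xs \<in> olists n m"
  unfolding olists_def del_nth_def
  by (auto dest: in_set_takeD in_set_dropD simp: set_take_disj_set_drop_if_distinct)

lemma cobdry_trunc: "xs \<in> olists n (Suc m) \<Longrightarrow> cobdry (trunc n m \<phi>) xs = cobdry \<phi> xs"
  by (rule cobdry_cong) (simp add: trunc_def del_nth_olists)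

section \<open>Supports as families of simplices\<close>

lemma skew_zero_iff:
  assumes "skew \<phi>" "distinct xs" "distinct ys" "set xs = set ys"
  shows "\<phi> xs = 0 \<longleftrightarrow> \<phi> ys = 0"
proof -
  have "mset xs = mset ys" using assms(2-4) by (simp add: set_eq_iff_mset_eq_distinct)
  then obtain \<pi> where "\<pi> permutes {..<length ys}" "permute_list \<pi> ys = xs"
    by (rule mset_eq_permutation)
  then show ?thesis using skew_permute[OF assms(1), of \<pi> "length ys" ys] by auto
qed

lemma mem_support_iff:
  assumes "skew \<phi>" "xs \<in> olists n m"
  shows "set xs \<in> support n m \<phi> \<longleftrightarrow> \<phi> xs \<noteq> 0"
  using assms skew_zero_iff[OF assms(1)] by (auto simp: support_def olists_def)

lemma support_trunc [simp]: "support n m (trunc n m \<phi>) = support n m \<phi>"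
  by (auto simp: support_def trunc_def)

lemma ksimplices_conv: "\<sigma> \<in> ksimplices n m \<longleftrightarrow> \<sigma> \<subseteq> {1..n} \<and> card \<sigma> = Suc m"
  by (auto simp: ksimplices_def)

lemma finite_ksimplices [simp]: "finite (ksimplices n m)"
  by (rule finite_subset[of _ "Pow {1..n}"]) (auto simp: ksimplices_def)

lemma card_ksimplices: "card (ksimplices n m) = n choose Suc m"
  using n_subsets[of "{1..n}" "Suc m"] by (simp add: ksimplices_def)

lemma set_olists: "xs \<in> olists n (Suc m) \<Longrightarrow> set xs \<in> ksimplices n m"
  by (auto simp: olists_def ksimplices_def distinct_card)

lemma sorted_list_olists:
  assumes "\<sigma> \<in> ksimplices n m"
  shows "sorted_list_of_set \<sigma> \<in> olists n (Suc m)" "set (sorted_list_of_set \<sigma>) = \<sigma>"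
proof -
  have "finite \<sigma>" using assms finite_subset by (auto simp: ksimplices_def)
  then show "sorted_list_of_set \<sigma> \<in> olists n (Suc m)" "set (sorted_list_of_set \<sigma>) = \<sigma>"
    using assms by (auto simp: olists_def ksimplices_def)
qed

lemma support_subset: "support n (Suc m) \<phi> \<subseteq> ksimplices n m"
  by (auto simp: support_def set_olists)

lemma finite_support [simp]: "finite (support n (Suc m) \<phi>)"
  using finite_subset[OF support_subset] by simp

text \<open>The cocycle condition becomes the event that \<open>S\<close> avoids a family of
  simplices depending on \<open>\<phi>\<close> alone, whose probability is explicit. Extension by
  zero passes from cochains on faces to functions skew on all lists.\<close>

lemma cohom_vanishes_iff:
  assumes "S \<subseteq> ksimplices n (Suc j)"
  shows "cohom_vanishes (R :: 'r::ab_group_add itself) n (Suc j) S \<longleftrightarrow>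
    (\<forall>\<phi> :: nat list \<Rightarrow> 'r. skew \<phi> \<and> S \<inter> support n (Suc (Suc j)) (cobdry \<phi>) = {} \<longrightarrow>
       (\<exists>\<psi>. skew \<psi> \<and> support n (Suc j) (\<lambda>xs. \<phi> xs - cobdry \<psi> xs) = {}))"
    (is "_ \<longleftrightarrow> (\<forall>\<phi>. ?A \<phi> \<longrightarrow> ?B \<phi>)")
proof -
  \<comment> \<open>With \<open>k = Suc j\<close>, faces with \<open>k\<close> or
    \<open>k - 1\<close> vertices belong to every complex of the model.\<close>
  have fc: "ofaces n (Suc j) S (Suc j) = olists n (Suc j)" "ofaces n (Suc j) S (Suc j - 1) = olists n j"
    by (simp_all add: ofaces_eq_olists)
  have len: "xs \<in> olists n m \<Longrightarrow> length xs = m" for xs m by (simp add: olists_def)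
  have cocyc: "(\<forall>xs\<in>ofaces n (Suc j) S (Suc j + 1). cobdry \<phi> xs = 0) \<longleftrightarrow>
      S \<inter> support n (Suc (Suc j)) (cobdry \<phi>) = {}" for \<phi> :: "nat list \<Rightarrow> 'r"
    unfolding ofaces_top by (auto simp: support_def)
  have cobd: "(\<forall>xs\<in>olists n (Suc j). cobdry \<psi> xs = \<phi> xs) \<longleftrightarrow>
      support n (Suc j) (\<lambda>xs. \<phi> xs - cobdry \<psi> xs) = {}" for \<phi> \<psi> :: "nat list \<Rightarrow> 'r"
    by (auto simp: support_def)
  show ?thesis
  proof
    assume v: "cohom_vanishes R n (Suc j) S"
    show "\<forall>\<phi>. ?A \<phi> \<longrightarrow> ?B \<phi>"
    proof (intro allI impI)
      fix \<phi> :: "nat list \<Rightarrow> 'r" assume a: "?A \<phi>"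
      then have "is_cochain (olists n (Suc j)) (Suc j) \<phi>"
        using skew_imp_is_cochain len by blast
      then obtain \<psi> :: "nat list \<Rightarrow> 'r" where p: "is_cochain (olists n j) j \<psi>"
        "\<forall>xs\<in>olists n (Suc j). cobdry \<psi> xs = \<phi> xs"
        using v a unfolding cohom_vanishes_def cocyc fc by auto
      have "support n (Suc j) (\<lambda>xs. \<phi> xs - cobdry (trunc n j \<psi>) xs) = {}"
        using p(2) unfolding cobd[symmetric] by (simp add: cobdry_trunc)
      then show "?B \<phi>" using is_cochain_imp_skew_trunc[OF p(1)] by blast
    qed
  next
    assume v: "\<forall>\<phi>. ?A \<phi> \<longrightarrow> ?B \<phi>"
    show "cohom_vanishes R n (Suc j) S"
      unfolding cohom_vanishes_def cocyc fc
    proof (intro allI impI)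
      fix \<phi> :: "nat list \<Rightarrow> 'r"
      assume a: "is_cochain (olists n (Suc j)) (Suc j) \<phi> \<and> S \<inter> support n (Suc (Suc j)) (cobdry \<phi>) = {}"
      have "support n (Suc (Suc j)) (cobdry (trunc n (Suc j) \<phi>)) = support n (Suc (Suc j)) (cobdry \<phi>)"
        by (auto simp: support_def cobdry_trunc)
      then obtain \<psi> where p: "skew \<psi>" "support n (Suc j) (\<lambda>xs. trunc n (Suc j) \<phi> xs - cobdry \<psi> xs) = {}"
        using v a is_cochain_imp_skew_trunc by metis
      have "\<forall>xs\<in>olists n (Suc j). cobdry \<psi> xs = \<phi> xs"
        using p(2) unfolding cobd[symmetric] by (simp add: trunc_def)
      then show "\<exists>\<psi>. is_cochain (olists n j) (Suc j - 1) \<psi> \<and> (\<forall>xs\<in>olists n (Suc j). cobdry \<psi> xs = \<phi> xs)"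
        using skew_imp_is_cochain[OF p(1)] len by (metis diff_Suc_1)
    qed
  qed
qed

section \<open>Expansion of minimal cochains\<close>

text \<open>Throughout, \<open>Suc j\<close> plays the role of \<open>k\<close>: the \<open>(k-1)\<close>-faces are the elements of
  \<open>ksimplices n j\<close>, and \<open>support n (Suc (Suc j)) (cobdry \<phi>)\<close> is the set of \<open>k\<close>-simplices that must
  be missing from a complex in which \<open>\<phi>\<close> is a cocycle.\<close>

definition weight_minimal :: "nat \<Rightarrow> nat \<Rightarrow> (nat list \<Rightarrow> 'r::ab_group_add) \<Rightarrow> bool" where
  "weight_minimal n m \<phi> \<longleftrightarrow> skew \<phi> \<and> (\<forall>xs. xs \<notin> olists n m \<longrightarrow> \<phi> xs = 0) \<and>
     (\<forall>\<psi>. skew \<psi> \<longrightarrow> card (support n m \<phi>) \<le> card (support n m (\<lambda>xs. \<phi> xs - cobdry \<psi> xs)))"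

text \<open>Adjacency through a common coface. A face is not its own neighbour, as its union with
  itself has too few vertices.\<close>

definition nbrs :: "nat \<Rightarrow> nat \<Rightarrow> nat set \<Rightarrow> nat set set" where
  "nbrs n j \<sigma> = {\<sigma>' \<in> ksimplices n j. card (\<sigma> \<union> \<sigma>') = Suc (Suc j)}"

text \<open>In a nontrivial class a representative of least support is chosen. Subtracting a
  coboundary alters neither the coboundary of the cochain nor its class, so the representative is
  still a cocycle of \<open>S\<close> with nonempty support.\<close>

lemma not_cohom_vanishes_imp_minimal:
  fixes R :: "'r::ab_group_add itself"
  assumes "S \<subseteq> ksimplices n (Suc j)" "\<not> cohom_vanishes R n (Suc j) S"
  shows "\<exists>\<phi> :: nat list \<Rightarrow> 'r. weight_minimal n (Suc j) \<phi> \<and> support n (Suc j) \<phi> \<noteq> {} \<and>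
    S \<inter> support n (Suc (Suc j)) (cobdry \<phi>) = {}"
proof -
  obtain \<phi> :: "nat list \<Rightarrow> 'r" where \<phi>: "skew \<phi>" "S \<inter> support n (Suc (Suc j)) (cobdry \<phi>) = {}"
    "\<And>\<psi>. skew \<psi> \<Longrightarrow> support n (Suc j) (\<lambda>xs. \<phi> xs - cobdry \<psi> xs) \<noteq> {}"
    using assms cohom_vanishes_iff by metis
  let ?w = "\<lambda>\<psi>. card (support n (Suc j) (\<lambda>xs. \<phi> xs - cobdry \<psi> xs))"
  \<comment> \<open>The zero cochain shows that the minimum is taken over a nonempty set.\<close>
  have "skew (\<lambda>_::nat list. 0::'r)" by (simp add: skew_def)
  then obtain \<psi> where \<psi>: "skew \<psi>" "\<And>\<psi>'. skew \<psi>' \<Longrightarrow> ?w \<psi> \<le> ?w \<psi>'"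
    using ex_has_least_nat[of skew _ ?w] by metis
  let ?\<chi> = "\<lambda>xs. \<phi> xs - cobdry \<psi> xs"
  let ?\<theta> = "trunc n (Suc j) ?\<chi>"
  have "card (support n (Suc j) ?\<theta>) \<le> card (support n (Suc j) (\<lambda>xs. ?\<theta> xs - cobdry \<psi>' xs))"
    if "skew \<psi>'" for \<psi>'
  proof -
    have "support n (Suc j) (\<lambda>xs. ?\<theta> xs - cobdry \<psi>' xs) =
        support n (Suc j) (\<lambda>xs. \<phi> xs - cobdry (\<lambda>ys. \<psi> ys + \<psi>' ys) xs)"
      by (auto simp: support_def trunc_def cobdry_add algebra_simps)
    then show ?thesis using \<psi>(2)[OF skew_add[OF \<psi>(1) that]] by simp
  qed
  moreover have "skew ?\<theta>" by (intro skew_trunc skew_diff skew_cobdry \<phi> \<psi>)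
  ultimately have "weight_minimal n (Suc j) ?\<theta>"
    by (simp add: weight_minimal_def trunc_def)
  moreover have "support n (Suc (Suc j)) (cobdry ?\<theta>) = support n (Suc (Suc j)) (cobdry \<phi>)"
    by (auto simp: support_def cobdry_trunc cobdry_diff cobdry_cobdry)
  moreover have "support n (Suc j) ?\<theta> \<noteq> {}" using \<phi>(3)[OF \<psi>(1)] by simp
  ultimately show ?thesis using \<phi>(2) by metis
qed

text \<open>For every vertex \<open>u\<close>, subtracting from \<open>\<phi>\<close> the coboundary of \<open>xs \<mapsto> \<phi> (u # xs)\<close> leaves a cochain
  supported on the links at \<open>u\<close> of the simplices in the support of \<open>cobdry \<phi>\<close>; minimality bounds the
  size of each of these, and one averages over \<open>u\<close>.\<close>

lemma weight_minimal_expansion: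
  assumes "weight_minimal n (Suc j) \<phi>"
  shows "n * card (support n (Suc j) \<phi>) \<le> Suc (Suc j) * card (support n (Suc (Suc j)) (cobdry \<phi>))"
proof -
  let ?D = "support n (Suc (Suc j)) (cobdry \<phi>)"
  define E where "E = (\<lambda>u. {\<sigma> \<in> ksimplices n j. u \<notin> \<sigma> \<and> insert u \<sigma> \<in> ?D})"
  have sk: "skew \<phi>" and zero: "\<And>xs. xs \<notin> olists n (Suc j) \<Longrightarrow> \<phi> xs = 0"
    using assms by (auto simp: weight_minimal_def)
  have le: "card (support n (Suc j) \<phi>) \<le> card (E u)" if u: "u \<in> {1..n}" for u
  proof -
    let ?\<psi> = "\<lambda>xs. \<phi> (u # xs)"
    let ?\<theta> = "\<lambda>xs. \<phi> xs - cobdry ?\<psi> xs"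
    have skt: "skew ?\<theta>" by (intro skew_diff skew_cobdry skew_Cons sk)
    have "support n (Suc j) ?\<theta> \<subseteq> E u"
    proof
      fix \<sigma> assume "\<sigma> \<in> support n (Suc j) ?\<theta>"
      then obtain xs where xs: "xs \<in> olists n (Suc j)" "?\<theta> xs \<noteq> 0" "\<sigma> = set xs"
        by (auto simp: support_def)
      \<comment> \<open>If \<open>u\<close> occurred in \<open>xs\<close>, it could be moved to the
        front. There the two copies of \<open>\<phi> (u # ?ys)\<close> cancel, and the other terms
        have \<open>u\<close> repeated. They vanish because \<open>\<phi>\<close> is zero off
        distinct lists; skewness alone would only make twice their value zero.\<close>
      have nu: "u \<notin> set xs"
      proof
        assume i: "u \<in> set xs"
        let ?ys = "remove1 u xs"
        have "distinct xs" using xs by (simp add: olists_def)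
        then have "distinct (u # ?ys)" "set (u # ?ys) = set xs" using i by auto
        then have "?\<theta> (u # ?ys) \<noteq> 0"
          using skew_zero_iff[OF skt \<open>distinct xs\<close>] xs(2) by metis
        moreover have "\<phi> (u # u # zs) = 0" for zs by (rule zero) (simp add: olists_def)
        ultimately show False by (simp add: cobdry_Cons cobdry_eq_0)
      qed
      then have "u # xs \<in> olists n (Suc (Suc j))" "cobdry \<phi> (u # xs) \<noteq> 0"
        using xs u by (auto simp: olists_def cobdry_Cons)
      then have "set (u # xs) \<in> ?D" unfolding support_def by blast
      then show "\<sigma> \<in> E u" using xs nu by (simp add: E_def set_olists)
    qed
    then have "card (support n (Suc j) ?\<theta>) \<le> card (E u)"
      by (intro card_mono) (auto simp: E_def)
    moreover have "card (support n (Suc j) \<phi>) \<le> card (support n (Suc j) ?\<theta>)"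
      using assms skew_Cons[OF sk] unfolding weight_minimal_def by blast
    ultimately show ?thesis by simp
  qed
  have ct: "card \<tau> = Suc (Suc j)" "finite \<tau>" if "\<tau> \<in> ?D" for \<tau>
  proof -
    show "card \<tau> = Suc (Suc j)"
      using that support_subset[of n "Suc j" "cobdry \<phi>"] by (auto simp: ksimplices_def)
    then show "finite \<tau>" using card.infinite by fastforce
  qed
  \<comment> \<open>Double counting: pairs \<open>(u, \<sigma>)\<close> inject into pairs of a
    simplex in \<open>?D\<close> and one of its \<open>Suc (Suc j)\<close> vertices.\<close>
  have "n * card (support n (Suc j) \<phi>) \<le> (\<Sum>u\<in>{1..n}. card (E u))"
    using sum_bounded_below[of "{1..n}" "card (support n (Suc j) \<phi>)" "\<lambda>u. card (E u)"] le by simp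
  also have "\<dots> = card (Sigma {1..n} E)"
    by (subst card_SigmaI) (auto simp: E_def)
  also have "\<dots> \<le> card (Sigma ?D (\<lambda>\<tau>. \<tau>))"
  proof (rule card_inj_on_le[where f = "\<lambda>(u, \<sigma>). (insert u \<sigma>, u)"])
    show "inj_on (\<lambda>(u, \<sigma>). (insert u \<sigma>, u)) (Sigma {1..n} E)"
      by (rule inj_onI) (auto simp: E_def insert_ident)
  qed (auto simp: E_def ct)
  also have "\<dots> = (\<Sum>\<tau>\<in>?D. card \<tau>)"
    by (subst card_SigmaI) (auto simp: ct)
  also have "\<dots> = Suc (Suc j) * card ?D" by (simp add: ct)
  finally show ?thesis .
qed

text \<open>If \<open>\<sigma>\<close> is the only face of \<open>insert v \<sigma>\<close> in the
  support, the coboundary there has a single nonzero term. Each neighbour of \<open>\<sigma>\<close>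
  in the support blocks at most one \<open>v\<close>, which leaves at least
  \<open>n - Suc j - d\<close> choices. A simplex obtained in this way determines
  \<open>\<sigma>\<close>, so nothing is counted twice.\<close>

lemma sparse_support_cobdry_lower_bound:
  assumes "skew \<phi>" "L \<subseteq> support n (Suc j) \<phi>"
    and deg: "\<And>\<sigma>. \<sigma> \<in> L \<Longrightarrow> card (nbrs n j \<sigma> \<inter> support n (Suc j) \<phi>) \<le> d"
  shows "card L * (n - Suc j - d) \<le> card (support n (Suc (Suc j)) (cobdry \<phi>))"
proof -
  let ?F = "support n (Suc j) \<phi>"
  let ?D = "support n (Suc (Suc j)) (cobdry \<phi>)"
  define G where "G = (\<lambda>\<sigma>. {insert v \<sigma> | v. v \<in> {1..n} - \<sigma> \<and> (\<forall>\<sigma>'\<in>?F. \<sigma>' \<subseteq> insert v \<sigma> \<longrightarrow> \<sigma>' = \<sigma>)})"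
  have F: "\<sigma> \<in> ksimplices n j" "\<sigma> \<subseteq> {1..n}" "card \<sigma> = Suc j" "finite \<sigma>" if "\<sigma> \<in> ?F" for \<sigma>
  proof -
    show "\<sigma> \<in> ksimplices n j" using that support_subset by blast
    then show "\<sigma> \<subseteq> {1..n}" "card \<sigma> = Suc j" by (auto simp: ksimplices_def)
    then show "finite \<sigma>" using finite_subset by blast
  qed
  have sub: "G \<sigma> \<subseteq> ?D" if \<sigma>: "\<sigma> \<in> ?F" for \<sigma>
  proof
    fix \<tau> assume "\<tau> \<in> G \<sigma>"
    then obtain v where v: "\<tau> = insert v \<sigma>" "v \<in> {1..n}" "v \<notin> \<sigma>"
      and uniq: "\<And>\<sigma>'. \<sigma>' \<in> ?F \<Longrightarrow> \<sigma>' \<subseteq> insert v \<sigma> \<Longrightarrow> \<sigma>' = \<sigma>"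
      by (auto simp: G_def)
    let ?ys = "sorted_list_of_set \<sigma>"
    have ys: "?ys \<in> olists n (Suc j)" "set ?ys = \<sigma>"
      using sorted_list_olists F(1)[OF \<sigma>] by auto
    have vys: "v # ?ys \<in> olists n (Suc (Suc j))" using ys v by (auto simp: olists_def)
    have "\<phi> (v # del_nth i ?ys) = 0" if i: "i < length ?ys" for i
    proof (rule ccontr)
      assume nz: "\<phi> (v # del_nth i ?ys) \<noteq> 0"
      have "del_nth (Suc i) (v # ?ys) \<in> olists n (Suc j)"
        using del_nth_olists[OF vys, of "Suc i"] i by simp
      then have o: "v # del_nth i ?ys \<in> olists n (Suc j)" by (simp add: del_nth_def)
      then have "set (v # del_nth i ?ys) \<in> ?F" using mem_support_iff[OF assms(1)] nz by blast
      moreover have "set (v # del_nth i ?ys) \<subseteq> insert v \<sigma>"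
        using ys(2) by (auto simp: del_nth_def simp del: set_sorted_list_of_set dest: in_set_takeD in_set_dropD)
      ultimately have "set (v # del_nth i ?ys) = \<sigma>" by (rule uniq)
      then show False using v(3) by auto
    qed
    then have "cobdry (\<lambda>zs. \<phi> (v # zs)) ?ys = 0" by (rule cobdry_eq_0)
    then have "cobdry \<phi> (v # ?ys) = \<phi> ?ys" by (simp add: cobdry_Cons)
    moreover have "\<phi> ?ys \<noteq> 0" using mem_support_iff[OF assms(1) ys(1)] ys(2) \<sigma> by simp
    ultimately have "set (v # ?ys) \<in> ?D"
      using mem_support_iff[OF skew_cobdry[OF assms(1)] vys] by metis
    then show "\<tau> \<in> ?D" using ys v by simp
  qed
  have cG: "n - Suc j - d \<le> card (G \<sigma>)" if \<sigma>: "\<sigma> \<in> L" for \<sigma>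
  proof -
    have \<sigma>F: "\<sigma> \<in> ?F" using \<sigma> assms(2) by auto
    note f = F[OF \<sigma>F]
    define A where "A = {v \<in> {1..n} - \<sigma>. \<forall>\<sigma>'\<in>?F. \<sigma>' \<subseteq> insert v \<sigma> \<longrightarrow> \<sigma>' = \<sigma>}"
    define B where "B = {1..n} - \<sigma> - A"
    \<comment> \<open>Each blocked vertex \<open>v\<close> is charged to a second face
      \<open>s v\<close> in the support; its union with \<open>\<sigma>\<close> recovers
      \<open>v\<close>, so the charge is injective.\<close>
    have "\<forall>v\<in>B. \<exists>\<sigma>'\<in>?F. \<sigma>' \<subseteq> insert v \<sigma> \<and> \<sigma>' \<noteq> \<sigma>" by (auto simp: A_def B_def)
    then obtain s where s: "\<And>v. v \<in> B \<Longrightarrow> s v \<in> ?F \<and> s v \<subseteq> insert v \<sigma> \<and> s v \<noteq> \<sigma>" by metis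
    have un: "\<sigma> \<union> s v = insert v \<sigma>" if "v \<in> B" for v
    proof -
      have "\<not> s v \<subseteq> \<sigma>" using s[OF that] F(3) f(3,4) by (metis card_subset_eq)
      then show ?thesis using s[OF that] by auto
    qed
    have "card B \<le> card (nbrs n j \<sigma> \<inter> ?F)"
    proof (rule card_inj_on_le[where f = s])
      show "inj_on s B"
      proof (rule inj_onI)
        fix v w assume "v \<in> B" "w \<in> B" "s v = s w"
        then have "insert v \<sigma> = insert w \<sigma>" using un by metis
        then show "v = w" using \<open>v \<in> B\<close> \<open>w \<in> B\<close> by (auto simp: B_def)
      qed
      show "s ` B \<subseteq> nbrs n j \<sigma> \<inter> ?F"
        using s un F(1) f(3,4) by (auto simp: nbrs_def B_def)
    qed simp
    then have "card B \<le> d" using deg[OF \<sigma>] by simp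
    moreover have "card A + card B = n - Suc j"
    proof -
      have "card ({1..n} - \<sigma>) = n - Suc j" using f by (simp add: card_Diff_subset)
      moreover have "card (A \<union> B) = card A + card B"
        by (rule card_Un_disjoint) (auto simp: A_def B_def)
      moreover have "A \<union> B = {1..n} - \<sigma>" by (auto simp: A_def B_def)
      ultimately show ?thesis by simp
    qed
    moreover have "card A \<le> card (G \<sigma>)"
    proof (rule card_inj_on_le[where f = "\<lambda>v. insert v \<sigma>"])
      show "inj_on (\<lambda>v. insert v \<sigma>) A" by (rule inj_onI) (auto simp: A_def)
      show "(\<lambda>v. insert v \<sigma>) ` A \<subseteq> G \<sigma>" by (auto simp: A_def G_def)
      show "finite (G \<sigma>)" using finite_subset[OF sub[OF \<sigma>F]] by simp
    qed
    ultimately show ?thesis by linarith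
  qed
  have finL: "finite L" using assms(2) finite_subset finite_support by blast
  have "card L * (n - Suc j - d) \<le> (\<Sum>\<sigma>\<in>L. card (G \<sigma>))"
    using sum_bounded_below[of L "n - Suc j - d" "\<lambda>\<sigma>. card (G \<sigma>)"] cG by simp
  also have "\<dots> = card (\<Union>\<sigma>\<in>L. G \<sigma>)"
  proof (rule card_UN_disjoint[symmetric])
    show "\<forall>\<sigma>\<in>L. finite (G \<sigma>)" by (meson assms(2) finite_subset finite_support sub subsetD)
    show "\<forall>\<sigma>\<in>L. \<forall>\<sigma>'\<in>L. \<sigma> \<noteq> \<sigma>' \<longrightarrow> G \<sigma> \<inter> G \<sigma>' = {}"
    proof (intro ballI impI)
      fix \<sigma> \<sigma>' assume h: "\<sigma> \<in> L" "\<sigma>' \<in> L" "\<sigma> \<noteq> \<sigma>'"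
      show "G \<sigma> \<inter> G \<sigma>' = {}"
      proof (rule ccontr)
        assume "G \<sigma> \<inter> G \<sigma>' \<noteq> {}"
        then obtain \<tau> where t: "\<tau> \<in> G \<sigma>" "\<tau> \<in> G \<sigma>'" by blast
        have "\<sigma> \<subseteq> \<tau>" using t(1) unfolding G_def by blast
        then have "\<sigma> = \<sigma>'" using t(2) h(1) assms(2) unfolding G_def by blast
        then show False using h(3) by simp
      qed
    qed
  qed (fact finL)
  also have "\<dots> \<le> card ?D" using sub assms(2) by (intro card_mono) auto
  finally show ?thesis .
qed

section \<open>Isolated faces and the second moment\<close>

definition cofaces :: "nat \<Rightarrow> nat \<Rightarrow> nat set \<Rightarrow> nat set set" where
  "cofaces n j \<sigma> = {\<tau> \<in> ksimplices n (Suc j). \<sigma> \<subseteq> \<tau>}"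

section \<open>Probabilities in the random complex\<close>

lemma sum_binomial_weights:
  fixes p :: real
  assumes "finite K"
  shows "(\<Sum>S\<in>Pow K. p ^ card S * (1 - p) ^ (card K - card S)) = 1"
proof -
  have "(\<Sum>S\<in>Pow K. p ^ card S * (1 - p) ^ (card K - card S)) =
      (\<Sum>S\<in>Pow K. (\<Prod>x\<in>S. p) * (\<Prod>x\<in>K - S. 1 - p))"
    using assms by (intro sum.cong refl) (simp add: card_Diff_subset finite_subset)
  also have "\<dots> = (\<Prod>x\<in>K. p + (1 - p))" using assms by (rule prod_add[symmetric])
  finally show ?thesis by simp
qed

text \<open>The weight of \<open>S\<close> factors over simplices: those in \<open>T\<close>
  contribute \<open>1 - p\<close> each, and the free choices outside \<open>T\<close> sum to
  one.\<close>

lemma probY_disjoint: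
  assumes "T \<subseteq> ksimplices n k"
  shows "probY n k p (\<lambda>S. S \<inter> T = {}) = (1 - p) ^ card T"
proof -
  let ?K = "ksimplices n k"
  have fin: "finite T" using finite_subset[OF assms] by simp
  have "{S. S \<subseteq> ?K \<and> S \<inter> T = {}} = Pow (?K - T)" by auto
  then have "probY n k p (\<lambda>S. S \<inter> T = {}) =
      (\<Sum>S\<in>Pow (?K - T). p ^ card S * (1 - p) ^ (card ?K - card S))"
    by (simp add: probY_def)
  also have "\<dots> = (\<Sum>S\<in>Pow (?K - T). (1 - p) ^ card T * (p ^ card S * (1 - p) ^ (card (?K - T) - card S)))"
  proof (intro sum.cong refl)
    fix S assume S: "S \<in> Pow (?K - T)"
    have "card S \<le> card (?K - T)" using S by (intro card_mono) auto
    moreover have "card (?K - T) + card T = card ?K"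
      using assms fin by (simp add: card_Diff_subset card_mono)
    ultimately have "card ?K - card S = card T + (card (?K - T) - card S)" by linarith
    then show "p ^ card S * (1 - p) ^ (card ?K - card S) =
        (1 - p) ^ card T * (p ^ card S * (1 - p) ^ (card (?K - T) - card S))"
      by (simp add: power_add)
  qed
  also have "\<dots> = (1 - p) ^ card T"
    by (simp add: sum_distrib_left[symmetric] sum_binomial_weights)
  finally show ?thesis .
qed

lemma probY_conv:
  "probY n k p Q = (\<Sum>S\<in>Pow (ksimplices n k). p ^ card S * (1 - p) ^ (card (ksimplices n k) - card S) * of_bool (Q S))"
proof -
  have "{S. S \<subseteq> ksimplices n k \<and> Q S} = {S \<in> Pow (ksimplices n k). Q S}" by auto
  then show ?thesis unfolding probY_def
    by (simp only: sum.inter_filter finite_Pow_iff finite_ksimplices) (intro sum.cong refl, simp)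
qed

lemma probY_mono:
  assumes "0 \<le> p" "p \<le> 1" "\<And>S. S \<subseteq> ksimplices n k \<Longrightarrow> Q S \<Longrightarrow> Q' S"
  shows "probY n k p Q \<le> probY n k p Q'"
  unfolding probY_conv using assms by (intro sum_mono mult_left_mono) auto

lemma probY_nonneg: "0 \<le> p \<Longrightarrow> p \<le> 1 \<Longrightarrow> 0 \<le> probY n k p Q"
  unfolding probY_conv by (intro sum_nonneg) auto

lemma probY_not: "probY n k p (\<lambda>S. \<not> Q S) = 1 - probY n k p Q"
proof -
  have "probY n k p (\<lambda>S. \<not> Q S) + probY n k p Q = 1"
    unfolding probY_conv sum.distrib[symmetric] distrib_left[symmetric]
    by (subst sum_binomial_weights[of "ksimplices n k" p, symmetric], simp) (intro sum.cong refl, simp)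
  then show ?thesis by simp
qed

lemma probY_union_bound:
  assumes "0 \<le> p" "p \<le> 1" "finite I"
  shows "probY n k p (\<lambda>S. \<exists>i\<in>I. Q i S) \<le> (\<Sum>i\<in>I. probY n k p (Q i))"
proof -
  have "of_bool (\<exists>i\<in>I. Q i S) \<le> (\<Sum>i\<in>I. of_bool (Q i S) :: real)" for S
  proof (cases "\<exists>i\<in>I. Q i S")
    case True
    then obtain i where "i \<in> I" "Q i S" by blast
    then show ?thesis using member_le_sum[of i I "\<lambda>i. of_bool (Q i S) :: real"] assms(3) by auto
  qed (simp add: sum_nonneg)
  then show ?thesis
    unfolding probY_conv
    by (subst sum.swap, unfold sum_distrib_left[symmetric], intro sum_mono mult_left_mono)
      (use assms in auto)
qed

text \<open>Chebyshev's inequality, multiplied out, for the number \<open>X\<close> of sets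
  \<open>T i\<close> missed by \<open>S\<close>: wherever \<open>X\<close> is zero, the squared
  deviation equals the square of the mean.\<close>

lemma probY_second_moment:
  assumes "0 \<le> p" "p \<le> 1" "finite I" "\<And>i. i \<in> I \<Longrightarrow> T i \<subseteq> ksimplices n k"
  shows "probY n k p (\<lambda>S. \<forall>i\<in>I. S \<inter> T i \<noteq> {}) * (\<Sum>i\<in>I. (1 - p) ^ card (T i))\<^sup>2 \<le>
    (\<Sum>i\<in>I. \<Sum>i'\<in>I. (1 - p) ^ card (T i \<union> T i')) - (\<Sum>i\<in>I. (1 - p) ^ card (T i))\<^sup>2"
proof -
  let ?P = "Pow (ksimplices n k)"
  define w where "w = (\<lambda>S :: nat set set. p ^ card S * (1 - p) ^ (card (ksimplices n k) - card S))"
  define X where "X = (\<lambda>S :: nat set set. \<Sum>i\<in>I. of_bool (S \<inter> T i = {}) :: real)"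
  define \<mu> where "\<mu> = (\<Sum>i\<in>I. (1 - p) ^ card (T i))"
  have w0: "0 \<le> w S" for S using assms(1,2) by (simp add: w_def)
  have w1: "(\<Sum>S\<in>?P. w S) = 1" by (simp add: w_def sum_binomial_weights)
  have pw: "probY n k p Q = (\<Sum>S\<in>?P. w S * of_bool (Q S))" for Q
    unfolding probY_conv w_def ..
  have dis: "(\<Sum>S\<in>?P. w S * of_bool (S \<inter> U = {})) = (1 - p) ^ card U" if "U \<subseteq> ksimplices n k" for U
    using probY_disjoint[OF that, of p] unfolding pw .
  have EX: "(\<Sum>S\<in>?P. w S * X S) = \<mu>"
    unfolding X_def \<mu>_def sum_distrib_left by (subst sum.swap) (intro sum.cong refl dis assms(4))
  \<comment> \<open>Missing both \<open>T i\<close> and \<open>T i'\<close> means missing their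
    union, so pair probabilities are explicit as well.\<close>
  have "(\<Sum>S\<in>?P. w S * (X S)\<^sup>2) =
      (\<Sum>S\<in>?P. \<Sum>i\<in>I. \<Sum>i'\<in>I. w S * of_bool (S \<inter> (T i \<union> T i') = {}))"
    unfolding X_def power2_eq_square sum_product sum_distrib_left
    by (intro sum.cong refl) (simp only: of_bool_conj sum_distrib_left sum_distrib_right Int_Un_distrib Un_empty ac_simps)
  also have "\<dots> = (\<Sum>i\<in>I. \<Sum>i'\<in>I. \<Sum>S\<in>?P. w S * of_bool (S \<inter> (T i \<union> T i') = {}))"
    by (subst sum.swap, intro sum.cong refl, subst sum.swap) (rule refl)
  also have "\<dots> = (\<Sum>i\<in>I. \<Sum>i'\<in>I. (1 - p) ^ card (T i \<union> T i'))"
    using assms(4) by (intro sum.cong refl dis) auto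
  finally have EX2: "(\<Sum>S\<in>?P. w S * (X S)\<^sup>2) = (\<Sum>i\<in>I. \<Sum>i'\<in>I. (1 - p) ^ card (T i \<union> T i'))" .
  have "probY n k p (\<lambda>S. \<forall>i\<in>I. S \<inter> T i \<noteq> {}) * \<mu>\<^sup>2 \<le> (\<Sum>S\<in>?P. w S * (X S - \<mu>)\<^sup>2)"
    unfolding pw sum_distrib_right
  proof (intro sum_mono)
    fix S
    show "w S * of_bool (\<forall>i\<in>I. S \<inter> T i \<noteq> {}) * \<mu>\<^sup>2 \<le> w S * (X S - \<mu>)\<^sup>2"
    proof (cases "\<forall>i\<in>I. S \<inter> T i \<noteq> {}")
      case True
      then have "X S = 0" unfolding X_def by (intro sum.neutral) auto
      then show ?thesis by (simp add: w0)
    next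
      case False
      then have "of_bool (\<forall>i\<in>I. S \<inter> T i \<noteq> {}) = (0::real)" by simp
      then show ?thesis using w0[of S] by (simp only: mult_zero_right mult_zero_left) simp
    qed
  qed
  also have "\<dots> = (\<Sum>S\<in>?P. w S * (X S)\<^sup>2) - 2 * \<mu> * (\<Sum>S\<in>?P. w S * X S) + \<mu>\<^sup>2 * (\<Sum>S\<in>?P. w S)"
    unfolding sum_distrib_left sum_subtractf[symmetric] sum.distrib[symmetric]
    by (intro sum.cong refl) (simp add: power2_eq_square algebra_simps)
  also have "\<dots> = (\<Sum>i\<in>I. \<Sum>i'\<in>I. (1 - p) ^ card (T i \<union> T i')) - \<mu>\<^sup>2"
    unfolding EX EX2 w1 by (simp add: power2_eq_square)
  finally show ?thesis unfolding \<mu>_def .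
qed

section \<open>The cochain carried by a single face\<close>

primrec inversions :: "nat list \<Rightarrow> nat" where
  "inversions [] = 0"
| "inversions (x # xs) = length (filter (\<lambda>y. y < x) xs) + inversions xs"

lemma even_inversions_swap:
  "a \<noteq> b \<Longrightarrow> even (inversions (as @ b # a # bs)) \<longleftrightarrow> odd (inversions (as @ a # b # bs))"
proof (induction as)
  case (Cons c as)
  have "length (filter (\<lambda>y. y < c) (as @ b # a # bs)) = length (filter (\<lambda>y. y < c) (as @ a # b # bs))"
    by simp
  then show ?case using Cons by (simp del: filter_append filter.simps)
qed (auto simp: not_less_iff_gr_or_eq)

text \<open>The elementary cochain of a face, oriented by the increasing order of its vertices: on
  distinct lists the parity of \<open>inversions\<close> is the sign of the ordering, and the sorted
  list gets the value \<open>r\<close>.\<close>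

definition simplex_cochain :: "nat set \<Rightarrow> 'r::ab_group_add \<Rightarrow> nat list \<Rightarrow> 'r" where
  "simplex_cochain \<sigma> r xs =
     (if distinct xs \<and> set xs = \<sigma> then if even (inversions xs) then r else - r else 0)"

lemma skew_simplex_cochain: "skew (simplex_cochain \<sigma> r)"
  unfolding skew_def
proof (intro allI)
  fix as bs and a b :: nat
  show "simplex_cochain \<sigma> r (as @ b # a # bs) = - simplex_cochain \<sigma> r (as @ a # b # bs)"
  proof (cases "distinct (as @ a # b # bs) \<and> set (as @ a # b # bs) = \<sigma>")
    case True
    then have "distinct (as @ b # a # bs) \<and> set (as @ b # a # bs) = \<sigma>" and "a \<noteq> b" by auto
    then show ?thesis using True even_inversions_swap[of a b as bs]
      unfolding simplex_cochain_def by (simp only: if_True) auto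
  next
    case False
    then have "\<not> (distinct (as @ b # a # bs) \<and> set (as @ b # a # bs) = \<sigma>)" by auto
    then show ?thesis using False unfolding simplex_cochain_def by (simp only: if_False) simp
  qed
qed

text \<open>The cochain of an isolated face is a cocycle of the complex, but not of the full simplex,
  and a coboundary would be a cocycle of both.\<close>

lemma isolated_simplex_not_cohom_vanishes:
  fixes R :: "'r::ab_group_add itself" and r :: 'r
  assumes "r \<noteq> 0" "Suc j < n" "S \<subseteq> ksimplices n (Suc j)"
    and \<sigma>: "\<sigma> \<in> ksimplices n j" and iso: "S \<inter> cofaces n j \<sigma> = {}"
  shows "\<not> cohom_vanishes R n (Suc j) S"
proof
  let ?\<phi> = "simplex_cochain \<sigma> r"
  assume "cohom_vanishes R n (Suc j) S"
  moreover have "support n (Suc (Suc j)) (cobdry ?\<phi>) \<subseteq> cofaces n j \<sigma>"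
  proof
    fix \<tau> assume "\<tau> \<in> support n (Suc (Suc j)) (cobdry ?\<phi>)"
    then obtain xs where xs: "xs \<in> olists n (Suc (Suc j))" "cobdry ?\<phi> xs \<noteq> 0" "\<tau> = set xs"
      by (auto simp: support_def)
    then obtain i where "?\<phi> (del_nth i xs) \<noteq> 0" using cobdry_eq_0 by metis
    then have "\<sigma> = set (del_nth i xs)" unfolding simplex_cochain_def by presburger
    then have "\<sigma> \<subseteq> \<tau>" using xs(3) by (auto simp: del_nth_def dest: in_set_takeD in_set_dropD)
    then show "\<tau> \<in> cofaces n j \<sigma>" using xs set_olists by (simp add: cofaces_def)
  qed
  ultimately obtain \<psi> where "support n (Suc j) (\<lambda>xs. ?\<phi> xs - cobdry \<psi> xs) = {}"
    using skew_simplex_cochain[of \<sigma> r] iso unfolding cohom_vanishes_iff[OF assms(3)] by blast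
  then have \<psi>: "?\<phi> xs = cobdry \<psi> xs" if "xs \<in> olists n (Suc j)" for xs
    using that by (auto simp: support_def)
  have "card \<sigma> < card {1..n}" using assms(2) \<sigma> by (simp add: ksimplices_def)
  then have "\<not> {1..n} \<subseteq> \<sigma>" using \<sigma> by (metis card_mono finite_atLeastAtMost finite_subset ksimplices_conv leD)
  then obtain v where v: "v \<in> {1..n}" "v \<notin> \<sigma>" by blast
  let ?ys = "sorted_list_of_set \<sigma>"
  have ys: "?ys \<in> olists n (Suc j)" "set ?ys = \<sigma>" using sorted_list_olists \<sigma> by auto
  have vys: "v # ?ys \<in> olists n (Suc (Suc j))" using ys v by (auto simp: olists_def)
  \<comment> \<open>Only deleting \<open>v\<close> leaves the face \<open>\<sigma>\<close>, so the
    left side reduces to \<open>?\<phi> ?ys\<close>, whereas the right side is zero.\<close>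
  have "cobdry ?\<phi> (v # ?ys) = cobdry (cobdry \<psi>) (v # ?ys)"
    by (intro cobdry_cong \<psi> del_nth_olists[OF vys])
  moreover have "cobdry (\<lambda>zs. ?\<phi> (v # zs)) ?ys = 0"
    using v(2) by (intro cobdry_eq_0) (auto simp: simplex_cochain_def)
  ultimately have "?\<phi> ?ys = 0"
    unfolding cobdry_cobdry by (simp add: cobdry_Cons)
  moreover have "distinct ?ys" by simp
  ultimately show False using ys(2) assms(1) unfolding simplex_cochain_def by (auto split: if_splits)
qed

section \<open>Counting neighbours and cofaces\<close>

lemma card_nbrs_le:
  assumes "\<sigma> \<in> ksimplices n j"
  shows "card (nbrs n j \<sigma>) \<le> Suc j * n"
proof -
  have \<sigma>: "finite \<sigma>" "card \<sigma> = Suc j" "\<sigma> \<subseteq> {1..n}"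
    using assms finite_subset by (auto simp: ksimplices_def)
  \<comment> \<open>A neighbour exchanges one vertex \<open>x\<close> of \<open>\<sigma>\<close> for
    another vertex \<open>v\<close>.\<close>
  have "nbrs n j \<sigma> \<subseteq> (\<lambda>(x, v). insert v (\<sigma> - {x})) ` (\<sigma> \<times> {1..n})"
  proof
    fix \<sigma>' assume "\<sigma>' \<in> nbrs n j \<sigma>"
    then have s: "card (\<sigma> \<union> \<sigma>') = Suc (Suc j)" "card \<sigma>' = Suc j" "\<sigma>' \<subseteq> {1..n}" "finite \<sigma>'"
      using finite_subset by (auto simp: nbrs_def ksimplices_def)
    have "card (\<sigma>' - \<sigma>) = 1" "card (\<sigma> - \<sigma>') = 1"
      using s \<sigma> card_Un_disjoint[of \<sigma> "\<sigma>' - \<sigma>"] card_Un_disjoint[of \<sigma>' "\<sigma> - \<sigma>'"]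
      by (auto simp: Un_commute)
    then obtain v x where "\<sigma>' - \<sigma> = {v}" "\<sigma> - \<sigma>' = {x}" by (meson card_1_singletonE)
    moreover from this have "\<sigma>' = insert v (\<sigma> - {x})" by blast
    ultimately show "\<sigma>' \<in> (\<lambda>(x, v). insert v (\<sigma> - {x})) ` (\<sigma> \<times> {1..n})"
      using s(3) by (intro image_eqI[of _ _ "(x, v)"]) auto
  qed
  then have "card (nbrs n j \<sigma>) \<le> card (\<sigma> \<times> {1..n})"
    using \<sigma> by (intro surj_card_le) auto
  then show ?thesis using \<sigma> by (simp add: card_cartesian_product)
qed

lemma card_cofaces:
  assumes "\<sigma> \<in> ksimplices n j"
  shows "card (cofaces n j \<sigma>) = n - Suc j"
proof -
  have \<sigma>: "finite \<sigma>" "card \<sigma> = Suc j" "\<sigma> \<subseteq> {1..n}"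
    using assms finite_subset by (auto simp: ksimplices_def)
  have "cofaces n j \<sigma> = (\<lambda>v. insert v \<sigma>) ` ({1..n} - \<sigma>)"
  proof
    show "cofaces n j \<sigma> \<subseteq> (\<lambda>v. insert v \<sigma>) ` ({1..n} - \<sigma>)"
    proof
      fix \<tau> assume "\<tau> \<in> cofaces n j \<sigma>"
      then have t: "\<sigma> \<subseteq> \<tau>" "card \<tau> = Suc (Suc j)" "\<tau> \<subseteq> {1..n}"
        by (auto simp: cofaces_def ksimplices_def)
      then have "card (\<tau> - \<sigma>) = 1" using \<sigma> by (simp add: card_Diff_subset)
      then obtain v where "\<tau> - \<sigma> = {v}" by (meson card_1_singletonE)
      then show "\<tau> \<in> (\<lambda>v. insert v \<sigma>) ` ({1..n} - \<sigma>)" using t by (intro image_eqI[of _ _ v]) auto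
    qed
    show "(\<lambda>v. insert v \<sigma>) ` ({1..n} - \<sigma>) \<subseteq> cofaces n j \<sigma>"
      using \<sigma> by (auto simp: cofaces_def ksimplices_def)
  qed
  moreover have "inj_on (\<lambda>v. insert v \<sigma>) ({1..n} - \<sigma>)" by (rule inj_onI) auto
  ultimately show ?thesis using \<sigma> by (simp add: card_image card_Diff_subset)
qed

text \<open>A common coface contains the union of the two faces. That union already has more than
  \<open>Suc j\<close> vertices, so it is the whole coface.\<close>

lemma card_cofaces_Int:
  assumes "\<sigma> \<in> ksimplices n j" "\<sigma>' \<in> ksimplices n j" "\<sigma> \<noteq> \<sigma>'"
  shows "card (cofaces n j \<sigma> \<inter> cofaces n j \<sigma>') \<le> of_bool (\<sigma>' \<in> nbrs n j \<sigma>)"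
proof -
  have s: "finite \<sigma>" "card \<sigma> = Suc j" "\<sigma> \<subseteq> {1..n}" "finite \<sigma>'" "card \<sigma>' = Suc j" "\<sigma>' \<subseteq> {1..n}"
    using assms finite_subset by (auto simp: ksimplices_def)
  have "\<not> \<sigma>' \<subseteq> \<sigma>" using s assms(3) by (metis card_subset_eq)
  then have "\<sigma> \<subset> \<sigma> \<union> \<sigma>'" by blast
  then have c: "Suc j < card (\<sigma> \<union> \<sigma>')" using s by (metis finite_UnI psubset_card_mono)
  have *: "\<tau> = \<sigma> \<union> \<sigma>' \<and> \<sigma>' \<in> nbrs n j \<sigma>" if "\<tau> \<in> cofaces n j \<sigma> \<inter> cofaces n j \<sigma>'" for \<tau>
  proof -
    have t: "\<sigma> \<union> \<sigma>' \<subseteq> \<tau>" "card \<tau> = Suc (Suc j)" "finite \<tau>"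
      using that finite_subset by (auto simp: cofaces_def ksimplices_def)
    then have "card (\<sigma> \<union> \<sigma>') = Suc (Suc j)" using c card_mono[of \<tau> "\<sigma> \<union> \<sigma>'"] by linarith
    then show ?thesis using t assms(2) card_subset_eq[of \<tau> "\<sigma> \<union> \<sigma>'"] by (simp add: nbrs_def)
  qed
  show ?thesis
  proof (cases "\<sigma>' \<in> nbrs n j \<sigma>")
    case True
    then show ?thesis using * card_mono[of "{\<sigma> \<union> \<sigma>'}" "cofaces n j \<sigma> \<inter> cofaces n j \<sigma>'"] by auto
  next
    case False
    then have "cofaces n j \<sigma> \<inter> cofaces n j \<sigma>' = {}" using * by blast
    then show ?thesis by simp
  qed
qed

text \<open>By Pascal's rule. It serves to replace \<open>n\<close> by the number of faces when
  neighbouring pairs are compared with the squared mean.\<close>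

lemma self_le_binomial: "Suc j < n \<Longrightarrow> n \<le> n choose Suc j"
proof (induction n)
  case (Suc n)
  show ?case
  proof (cases "Suc j = n")
    case True
    then show ?thesis using binomial_symmetric[of n "Suc n"] by simp
  next
    case False
    have "n \<le> n choose Suc j" using Suc False by auto
    moreover have "1 \<le> n choose j" using Suc.prems by (simp add: Suc_leI)
    ultimately show ?thesis by simp
  qed
qed simp

text \<open>Second moment for the number of isolated faces. Equal pairs contribute the reciprocal of
  the mean, non-neighbours are independent, and neighbours share at most one coface, which yields
  the correlation term with \<open>p\<close>.\<close>

lemma prob_no_isolated_le:
  assumes p: "0 \<le> p" "p \<le> 1 / 2" and n: "Suc j < n"
  shows "probY n (Suc j) p (\<lambda>S. \<forall>\<sigma>\<in>ksimplices n j. S \<inter> cofaces n j \<sigma> \<noteq> {}) \<le>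
    1 / (real (n choose Suc j) * (1 - p) ^ n) + 2 * real (Suc j) * p"
    (is "?P \<le> _")
proof -
  let ?I = "ksimplices n j"
  define q where "q = 1 - p"
  define a where "a = n - Suc j"
  define N where "N = real (n choose Suc j)"
  have q: "1 / 2 \<le> q" "q \<le> 1" "0 < q" using p by (auto simp: q_def)
  have cI: "real (card ?I) = N" by (simp add: card_ksimplices N_def)
  have Nn: "real n \<le> N" using self_le_binomial[OF n] by (simp add: N_def)
  then have N0: "0 < N" using n by simp
  have a1: "1 \<le> a" using n by (simp add: a_def)
  have fin: "finite (cofaces n j \<sigma>)" for \<sigma> by (simp add: cofaces_def)
  have pair: "q ^ card (cofaces n j \<sigma> \<union> cofaces n j \<sigma>') \<le>
      (if \<sigma>' = \<sigma> then q ^ a else 0) + q ^ (2 * a) +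
      of_bool (\<sigma>' \<in> nbrs n j \<sigma>) * (2 * p * q ^ (2 * a))"
    if s: "\<sigma> \<in> ?I" "\<sigma>' \<in> ?I" for \<sigma> \<sigma>'
  proof (cases "\<sigma>' = \<sigma>")
    case True
    then show ?thesis using q p by (simp add: card_cofaces[OF s(1)] a_def)
  next
    case False
    have sum: "card (cofaces n j \<sigma> \<union> cofaces n j \<sigma>') + card (cofaces n j \<sigma> \<inter> cofaces n j \<sigma>') = 2 * a"
      using card_Un_Int[OF fin fin, of \<sigma> \<sigma>'] s by (simp add: card_cofaces a_def)
    have i: "card (cofaces n j \<sigma> \<inter> cofaces n j \<sigma>') \<le> of_bool (\<sigma>' \<in> nbrs n j \<sigma>)"
      using card_cofaces_Int[OF s] False by auto
    show ?thesis
    proof (cases "\<sigma>' \<in> nbrs n j \<sigma>")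
      case True
      have "2 * a - 1 \<le> card (cofaces n j \<sigma> \<union> cofaces n j \<sigma>')" using sum i True by simp
      then have "q ^ card (cofaces n j \<sigma> \<union> cofaces n j \<sigma>') \<le> q ^ (2 * a - 1)"
        using q by (intro power_decreasing) auto
      \<comment> \<open>A shared coface saves one factor \<open>q\<close>, and
        \<open>1 / q \<le> 1 + 2 * p\<close> because \<open>p \<le> 1 / 2\<close>.\<close>
      also have "\<dots> = q * q ^ (2 * a - 1) + p * q ^ (2 * a - 1)" by (simp add: q_def algebra_simps)
      also have "q * q ^ (2 * a - 1) = q ^ (2 * a)" using a1 by (simp flip: power_Suc)
      also have "p * q ^ (2 * a - 1) \<le> 2 * p * (q * q ^ (2 * a - 1))"
      proof -
        have "p * q ^ (2 * a - 1) * 1 \<le> p * q ^ (2 * a - 1) * (2 * q)"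
          using q p by (intro mult_left_mono) auto
        then show ?thesis by (simp only: mult_1_right ac_simps)
      qed
      also have "q * q ^ (2 * a - 1) = q ^ (2 * a)" using a1 by (simp flip: power_Suc)
      finally show ?thesis using True False by simp
    next
      case False2: False
      then have "card (cofaces n j \<sigma> \<union> cofaces n j \<sigma>') = 2 * a" using sum i by simp
      then show ?thesis using False False2 by simp
    qed
  qed
  have row: "(\<Sum>\<sigma>'\<in>?I. q ^ card (cofaces n j \<sigma> \<union> cofaces n j \<sigma>')) \<le>
      q ^ a + N * q ^ (2 * a) + real (Suc j) * real n * (2 * p * q ^ (2 * a))" if s: "\<sigma> \<in> ?I" for \<sigma>
  proof -
    have "(\<Sum>\<sigma>'\<in>?I. q ^ card (cofaces n j \<sigma> \<union> cofaces n j \<sigma>')) \<le>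
        (\<Sum>\<sigma>'\<in>?I. (if \<sigma>' = \<sigma> then q ^ a else 0) + q ^ (2 * a) +
          of_bool (\<sigma>' \<in> nbrs n j \<sigma>) * (2 * p * q ^ (2 * a)))"
      using pair s by (intro sum_mono) auto
    also have "\<dots> = q ^ a + N * q ^ (2 * a) + real (card (?I \<inter> nbrs n j \<sigma>)) * (2 * p * q ^ (2 * a))"
      using s by (simp add: sum.distrib cI sum_distrib_right[symmetric] sum.delta Int_def of_bool_def sum.If_cases)
    also have "real (card (?I \<inter> nbrs n j \<sigma>)) \<le> real (Suc j * n)"
    proof -
      have "?I \<inter> nbrs n j \<sigma> = nbrs n j \<sigma>" by (auto simp: nbrs_def)
      then show ?thesis using card_nbrs_le[OF s] by (metis of_nat_le_iff)
    qed
    finally show ?thesis using q p by (simp add: mult_right_mono algebra_simps)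
  qed
  have \<mu>: "(\<Sum>\<sigma>\<in>?I. q ^ card (cofaces n j \<sigma>)) = N * q ^ a"
    by (simp add: card_cofaces a_def cI)
  have "?P * (N * q ^ a)\<^sup>2 \<le> (\<Sum>\<sigma>\<in>?I. \<Sum>\<sigma>'\<in>?I. q ^ card (cofaces n j \<sigma> \<union> cofaces n j \<sigma>')) - (N * q ^ a)\<^sup>2"
    using probY_second_moment[of p ?I "cofaces n j" n "Suc j"] p
    unfolding q_def[symmetric] \<mu> by (auto simp: cofaces_def)
  also have "\<dots> \<le> (\<Sum>\<sigma>\<in>?I. q ^ a + N * q ^ (2 * a) + real (Suc j) * real n * (2 * p * q ^ (2 * a))) - (N * q ^ a)\<^sup>2"
    using row by (intro diff_right_mono sum_mono)
  also have "\<dots> = N * q ^ a + N * (real (Suc j) * real n * (2 * p * q ^ (2 * a)))"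
    unfolding sum_constant cI by (simp only: power2_eq_square mult_2 power_add) (simp add: algebra_simps)
  also have "\<dots> \<le> N * q ^ a + N * (real (Suc j) * N * (2 * p * q ^ (2 * a)))"
    using Nn N0 p q by (intro add_left_mono mult_left_mono mult_right_mono) auto
  also have "\<dots> = (1 / (N * q ^ a) + 2 * real (Suc j) * p) * (N * q ^ a)\<^sup>2"
    using N0 q by (simp only: power2_eq_square mult_2 power_add) (simp add: field_simps)
  finally have "?P \<le> 1 / (N * q ^ a) + 2 * real (Suc j) * p"
    using N0 q by (simp add: mult_le_cancel_right)
  \<comment> \<open>The exponent \<open>n\<close> weakens the bound but removes the truncated
    subtraction.\<close>
  also have "1 / (N * q ^ a) \<le> 1 / (N * q ^ n)"
    using N0 q by (intro divide_left_mono mult_left_mono power_decreasing) (auto simp: a_def)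
  finally show ?thesis by (simp add: N_def q_def)
qed

section \<open>Counting minimal cochains\<close>

definition min_cochains :: "nat \<Rightarrow> nat \<Rightarrow> nat \<Rightarrow> (nat list \<Rightarrow> 'r::ab_group_add) set" where
  "min_cochains n j m = {\<phi>. weight_minimal n (Suc j) \<phi> \<and> card (support n (Suc j) \<phi>) = m}"

text \<open>By skewness such a cochain is determined by its values on the sorted orderings of the
  faces in \<open>F\<close>, so it embeds into the functions from \<open>F\<close> to the
  coefficients.\<close>

lemma cochains_with_support:
  fixes F :: "nat set set"
  assumes "F \<subseteq> ksimplices n j"
  defines "C \<equiv> {\<phi> :: nat list \<Rightarrow> 'r::{ab_group_add,finite}. weight_minimal n (Suc j) \<phi> \<and> support n (Suc j) \<phi> = F}"
  shows "finite C" "card C \<le> CARD('r) ^ card F"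
proof -
  define r where "r = (\<lambda>\<phi> :: nat list \<Rightarrow> 'r. restrict (\<lambda>\<sigma>. \<phi> (sorted_list_of_set \<sigma>)) F)"
  have finF: "finite F" using finite_subset[OF assms(1)] by simp
  have inj: "inj_on r C"
  proof (rule inj_onI, rule ext)
    fix \<phi> \<phi>' xs assume C: "\<phi> \<in> C" "\<phi>' \<in> C" and eq: "r \<phi> = r \<phi>'"
    have sk: "skew \<phi>" "skew \<phi>'" and zero: "\<And>xs. xs \<notin> olists n (Suc j) \<Longrightarrow> \<phi> xs = 0 \<and> \<phi>' xs = 0"
      and supp: "support n (Suc j) \<phi> = F" "support n (Suc j) \<phi>' = F"
      using C by (auto simp: C_def weight_minimal_def)
    show "\<phi> xs = \<phi>' xs"
    proof (cases "xs \<in> olists n (Suc j)")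
      case xs: True
      show ?thesis
      proof (cases "set xs \<in> F")
        case True
        let ?ys = "sorted_list_of_set (set xs)"
        have "\<phi> ?ys = \<phi>' ?ys" using fun_cong[OF eq, of "set xs"] True by (simp add: r_def)
        moreover have "mset xs = mset ?ys"
          using xs by (subst set_eq_iff_mset_eq_distinct[symmetric]) (auto simp: olists_def)
        then obtain \<pi> where "\<pi> permutes {..<length ?ys}" "permute_list \<pi> ?ys = xs"
          by (rule mset_eq_permutation)
        ultimately show ?thesis
          using skew_permute[OF sk(1), of \<pi> "length ?ys" ?ys] skew_permute[OF sk(2), of \<pi> "length ?ys" ?ys]
          by simp
      next
        case False
        then show ?thesis using mem_support_iff[OF sk(1) xs] mem_support_iff[OF sk(2) xs] supp by simp
      qed
    next
      case False
      then show ?thesis using zero by simp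
    qed
  qed
  have im: "r ` C \<subseteq> F \<rightarrow>\<^sub>E UNIV" by (auto simp: r_def)
  have fin: "finite (F \<rightarrow>\<^sub>E (UNIV :: 'r set))" using finF by (intro finite_PiE) auto
  show "finite C" using inj im fin by (rule inj_on_finite)
  have "card C \<le> card (F \<rightarrow>\<^sub>E (UNIV :: 'r set))" using inj im fin by (rule card_inj_on_le)
  then show "card C \<le> CARD('r) ^ card F" using finF by (simp add: card_PiE)
qed

lemma finite_min_cochains:
  "finite (min_cochains n j m :: (nat list \<Rightarrow> 'r::{ab_group_add,finite}) set)"
proof (rule finite_subset)
  show "(min_cochains n j m :: (nat list \<Rightarrow> 'r) set) \<subseteq>
      (\<Union>F\<in>Pow (ksimplices n j). {\<phi>. weight_minimal n (Suc j) \<phi> \<and> support n (Suc j) \<phi> = F})"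
    by (auto simp: min_cochains_def dest: subsetD[OF support_subset])
  show "finite (\<Union>F\<in>Pow (ksimplices n j). {\<phi> :: nat list \<Rightarrow> 'r. weight_minimal n (Suc j) \<phi> \<and> support n (Suc j) \<phi> = F})"
    using cochains_with_support(1) by (intro finite_UN_I) auto
qed

text \<open>Cochains are grouped by support; each support carries at most
  \<open>CARD('r) ^ m\<close> of them. From here on only supports have to be counted.\<close>

lemma sum_min_cochains_le:
  fixes g :: "nat set set \<Rightarrow> real" and f :: "(nat list \<Rightarrow> 'r::{ab_group_add,finite}) \<Rightarrow> real"
  assumes "\<And>\<phi>. \<phi> \<in> min_cochains n j m \<Longrightarrow> f \<phi> \<le> g (support n (Suc j) \<phi>)"
    and "\<And>F. 0 \<le> g F"
  shows "(\<Sum>\<phi>\<in>min_cochains n j m. f \<phi>) \<le>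
    real CARD('r) ^ m * (\<Sum>F\<in>support n (Suc j) ` (min_cochains n j m :: (nat list \<Rightarrow> 'r) set). g F)"
proof -
  let ?M = "min_cochains n j m :: (nat list \<Rightarrow> 'r) set"
  let ?s = "support n (Suc j)"
  have "(\<Sum>\<phi>\<in>?M. f \<phi>) = (\<Sum>F\<in>?s ` ?M. \<Sum>\<phi>\<in>{\<phi>. \<phi> \<in> ?M \<and> ?s \<phi> = F}. f \<phi>)"
    using finite_min_cochains by (rule sum.image_gen)
  also have "\<dots> \<le> (\<Sum>F\<in>?s ` ?M. real CARD('r) ^ m * g F)"
  proof (rule sum_mono)
    fix F assume "F \<in> ?s ` ?M"
    then have F: "card F = m" "F \<subseteq> ksimplices n j"
      by (auto simp: min_cochains_def dest: subsetD[OF support_subset])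
    have "{\<phi>. \<phi> \<in> ?M \<and> ?s \<phi> = F} \<subseteq> {\<phi> :: nat list \<Rightarrow> 'r. weight_minimal n (Suc j) \<phi> \<and> ?s \<phi> = F}"
      by (auto simp: min_cochains_def)
    then have "card {\<phi>. \<phi> \<in> ?M \<and> ?s \<phi> = F} \<le>
        card {\<phi> :: nat list \<Rightarrow> 'r. weight_minimal n (Suc j) \<phi> \<and> ?s \<phi> = F}"
      by (intro card_mono cochains_with_support(1) F(2))
    also have "\<dots> \<le> CARD('r) ^ m"
      using cochains_with_support(2)[OF F(2), where 'r = 'r] F(1) by simp
    finally have c: "card {\<phi>. \<phi> \<in> ?M \<and> ?s \<phi> = F} \<le> CARD('r) ^ m" .
    have "(\<Sum>\<phi>\<in>{\<phi>. \<phi> \<in> ?M \<and> ?s \<phi> = F}. f \<phi>) \<le> real (card {\<phi>. \<phi> \<in> ?M \<and> ?s \<phi> = F}) * g F"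
      using assms(1) by (intro sum_bounded_above) auto
    also have "\<dots> \<le> real CARD('r) ^ m * g F"
      using c assms(2) by (intro mult_right_mono) (metis of_nat_le_iff of_nat_power)
    finally show "(\<Sum>\<phi>\<in>{\<phi>. \<phi> \<in> ?M \<and> ?s \<phi> = F}. f \<phi>) \<le> real CARD('r) ^ m * g F" .
  qed
  finally show ?thesis by (simp add: sum_distrib_left)
qed

text \<open>Union bound over minimal cochains; the size \<open>m\<close> starts at one because a
  nontrivial class has nonempty support.\<close>

lemma prob_not_cohom_vanishes_le:
  fixes R :: "'r::{ab_group_add,finite} itself"
  assumes "0 \<le> p" "p \<le> 1"
  shows "probY n (Suc j) p (\<lambda>S. \<not> cohom_vanishes R n (Suc j) S) \<le>
    (\<Sum>m\<in>{1..n choose Suc j}. \<Sum>\<phi>\<in>(min_cochains n j m :: (nat list \<Rightarrow> 'r) set).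
       (1 - p) ^ card (support n (Suc (Suc j)) (cobdry \<phi>)))"
proof -
  let ?M = "\<lambda>m. min_cochains n j m :: (nat list \<Rightarrow> 'r) set"
  let ?I = "Sigma {1..n choose Suc j} ?M"
  let ?D = "\<lambda>\<phi> :: nat list \<Rightarrow> 'r. support n (Suc (Suc j)) (cobdry \<phi>)"
  have "probY n (Suc j) p (\<lambda>S. \<not> cohom_vanishes R n (Suc j) S) \<le>
      probY n (Suc j) p (\<lambda>S. \<exists>x\<in>?I. S \<inter> ?D (snd x) = {})"
  proof (rule probY_mono[OF assms])
    fix S assume "S \<subseteq> ksimplices n (Suc j)" "\<not> cohom_vanishes R n (Suc j) S"
    then obtain \<phi> :: "nat list \<Rightarrow> 'r" where \<phi>: "weight_minimal n (Suc j) \<phi>" "support n (Suc j) \<phi> \<noteq> {}"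
      "S \<inter> ?D \<phi> = {}"
      using not_cohom_vanishes_imp_minimal by blast
    let ?m = "card (support n (Suc j) \<phi>)"
    have "?m \<le> n choose Suc j"
      using card_mono[OF finite_ksimplices support_subset] by (simp add: card_ksimplices)
    moreover have "0 < ?m" using \<phi>(2) by (simp add: card_gt_0_iff)
    ultimately have "(?m, \<phi>) \<in> ?I" using \<phi>(1) by (auto simp: min_cochains_def)
    then show "\<exists>x\<in>?I. S \<inter> ?D (snd x) = {}" using \<phi>(3) by (intro bexI[of _ "(?m, \<phi>)"]) auto
  qed
  also have "\<dots> \<le> (\<Sum>x\<in>?I. probY n (Suc j) p (\<lambda>S. S \<inter> ?D (snd x) = {}))"
    by (rule probY_union_bound[OF assms]) (auto simp: finite_min_cochains)
  also have "\<dots> = (\<Sum>x\<in>?I. (1 - p) ^ card (?D (snd x)))"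
    by (intro sum.cong refl probY_disjoint support_subset)
  also have "\<dots> = (\<Sum>m\<in>{1..n choose Suc j}. \<Sum>\<phi>\<in>?M m. (1 - p) ^ card (?D \<phi>))"
    by (subst sum.Sigma) (auto simp: finite_min_cochains case_prod_beta)
  finally show ?thesis .
qed

text \<open>A maximal \<open>S\<close> each of whose members is charged \<open>x\<close> newly dominated points of \<open>H\<close>.\<close>

lemma greedy_dominating_set:
  fixes nb :: "'a \<Rightarrow> 'a set" and x y :: real
  assumes "finite F" "0 < x"
    and sym: "\<And>s t. s \<in> F \<Longrightarrow> t \<in> F \<Longrightarrow> t \<in> nb s \<longleftrightarrow> s \<in> nb t"
  defines "H \<equiv> {s \<in> F. y < card (nb s \<inter> F)}"
  shows "\<exists>S\<subseteq>F. card S * x \<le> card F \<and> card (H - (\<Union>s\<in>S. nb s)) * y \<le> card F * x"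
proof -
  let ?N = "\<lambda>S. \<Union>s\<in>S. nb s"
  have finH: "finite H" using assms(1) by (simp add: H_def)
  let ?A = "{S. S \<subseteq> F \<and> card S * x \<le> card (H \<inter> ?N S)}"
  have "finite ?A" using assms(1) by (intro finite_subset[of ?A "Pow F"]) auto
  moreover have "{} \<in> ?A" by simp
  ultimately obtain S where S: "S \<in> ?A" and max: "\<And>S'. S' \<in> ?A \<Longrightarrow> S \<subseteq> S' \<Longrightarrow> S = S'"
    using finite_has_maximal[of ?A] by (metis (no_types, lifting) empty_iff)
  have SF: "S \<subseteq> F" and Sx: "card S * x \<le> card (H \<inter> ?N S)" using S by auto
  have finS: "finite S" using SF assms(1) finite_subset by blast
  let ?H = "H - ?N S"
  \<comment> \<open>Otherwise \<open>s\<close> could be added to \<open>S\<close>, against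
    maximality.\<close>
  have few: "card (nb s \<inter> ?H) \<le> x" if s: "s \<in> F" for s
  proof (rule ccontr)
    assume big: "\<not> card (nb s \<inter> ?H) \<le> x"
    have sS: "s \<notin> S"
    proof
      assume "s \<in> S"
      then have "nb s \<inter> ?H = {}" by blast
      then show False using big assms(2) by simp
    qed
    have "H \<inter> ?N (insert s S) = (H \<inter> ?N S) \<union> (nb s \<inter> ?H)" by auto
    then have "card (H \<inter> ?N (insert s S)) = card (H \<inter> ?N S) + card (nb s \<inter> ?H)"
      using finH by (simp add: card_Un_disjoint Int_Diff disjoint_iff)
    moreover have "card (insert s S) * x = card S * x + x"
      using sS finS by (simp add: algebra_simps)
    ultimately have "insert s S \<in> ?A" using Sx SF s big by simp
    then show False using max[of "insert s S"] sS by blast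
  qed
  \<comment> \<open>Double counting of neighbouring pairs: an undominated member of \<open>H\<close>
    has more than \<open>y\<close> neighbours in \<open>F\<close>, while each member of
    \<open>F\<close> has at most \<open>x\<close> undominated neighbours in
    \<open>H\<close>.\<close>
  have "card ?H * y \<le> (\<Sum>h\<in>?H. real (card (nb h \<inter> F)))"
    using sum_bounded_below[of ?H y "\<lambda>h. real (card (nb h \<inter> F))"] by (auto simp: H_def mult.commute)
  also have "\<dots> = real (card (Sigma ?H (\<lambda>h. nb h \<inter> F)))"
    using finH assms(1) by (subst card_SigmaI) auto
  also have "card (Sigma ?H (\<lambda>h. nb h \<inter> F)) = card (Sigma F (\<lambda>s. nb s \<inter> ?H))"
    by (rule bij_betw_same_card[of prod.swap])
      (auto simp: bij_betw_def inj_on_def H_def sym image_iff)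
  also have "real (card (Sigma F (\<lambda>s. nb s \<inter> ?H))) = (\<Sum>s\<in>F. real (card (nb s \<inter> ?H)))"
    using finH assms(1) by (subst card_SigmaI) auto
  also have "\<dots> \<le> card F * x" using few by (rule sum_bounded_above)
  finally have "card ?H * y \<le> card F * x" .
  moreover have "card (H \<inter> ?N S) \<le> card F" using assms(1) by (intro card_mono) (auto simp: H_def)
  ultimately show ?thesis using SF Sx by (intro exI[of _ S]) auto
qed

section \<open>Elementary counting and exponential estimates\<close>

lemma card_bounded_subsets_le:
  assumes "finite A"
  shows "card {S. S \<subseteq> A \<and> card S \<le> s} \<le> Suc (card A) ^ s"
proof (induction s)
  case 0
  have "{S. S \<subseteq> A \<and> card S \<le> 0} = {{}}"
    by (auto simp: card_eq_0_iff dest: finite_subset[OF _ assms])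
  then show ?case by simp
next
  case (Suc s)
  let ?P = "{S. S \<subseteq> A \<and> card S \<le> s}"
  have fin: "finite ?P" using assms by simp
  \<comment> \<open>A set of size at most \<open>Suc s\<close> is either empty or a smaller set with
    one element inserted, whence the factor \<open>Suc (card A)\<close>.\<close>
  have "{S. S \<subseteq> A \<and> card S \<le> Suc s} \<subseteq> ?P \<union> (\<lambda>(x, S). insert x S) ` (A \<times> ?P)"
  proof
    fix S assume S: "S \<in> {S. S \<subseteq> A \<and> card S \<le> Suc s}"
    show "S \<in> ?P \<union> (\<lambda>(x, S). insert x S) ` (A \<times> ?P)"
    proof (cases "S = {}")
      case False
      then obtain x where x: "x \<in> S" by blast
      then have "S - {x} \<in> ?P" using S by (auto simp: card_Diff_singleton_if)
      then show ?thesis using x S by (intro UnI2 image_eqI[of _ _ "(x, S - {x})"]) auto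
    qed simp
  qed
  then have "card {S. S \<subseteq> A \<and> card S \<le> Suc s} \<le> card (?P \<union> (\<lambda>(x, S). insert x S) ` (A \<times> ?P))"
    using fin assms by (intro card_mono) auto
  also have "\<dots> \<le> card ?P + card (A \<times> ?P)"
    using fin assms by (intro order_trans[OF card_Un_le] add_left_mono card_image_le) auto
  also have "\<dots> = Suc (card A) * card ?P" by (simp add: card_cartesian_product)
  also have "\<dots> \<le> Suc (card A) * Suc (card A) ^ s" using Suc by (intro mult_left_mono) auto
  finally show ?case by simp
qed

lemma power_div_fact_le_exp:
  fixes x :: real
  assumes "0 \<le> x"
  shows "x ^ u / fact u \<le> exp x"
proof -
  have "(\<Sum>n\<in>{u}. x ^ n /\<^sub>R fact n) \<le> (\<Sum>n. x ^ n /\<^sub>R fact n)"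
    using assms by (intro sum_le_suminf summable_exp_generic) auto
  then show ?thesis by (simp add: exp_def divide_inverse mult.commute)
qed

lemma binomial_le_power_div_fact: "real (N choose u) \<le> real N ^ u / fact u"
proof (cases "u \<le> N")
  case True
  have "fact u * (N choose u) = fact N div fact (N - u)"
    using binomial_fact_lemma[OF True] by (metis div_mult_self1_is_m fact_gt_zero mult.commute mult.left_commute)
  also have "\<dots> \<le> N ^ u" using True by (rule fact_div_fact_le_pow)
  finally have "real (fact u * (N choose u)) \<le> real (N ^ u)" by (simp only: of_nat_le_iff)
  then show ?thesis by (simp add: field_simps)
qed (simp add: binomial_eq_0)

lemma power_one_minus_le_exp:
  fixes p :: real
  assumes "0 \<le> p" "p \<le> 1"
  shows "(1 - p) ^ b \<le> exp (- (p * b))"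
proof -
  have "(1 - p) ^ b \<le> exp (- p) ^ b"
    using assms exp_ge_add_one_self[of "- p"] by (intro power_mono) auto
  also have "\<dots> = exp (- (p * b))" by (simp add: exp_of_nat_mult[symmetric] mult.commute)
  finally show ?thesis .
qed

lemma binomial_le_power: "real (N choose u) \<le> real N ^ u"
proof -
  have "real N ^ u / fact u \<le> real N ^ u / 1"
    by (intro divide_left_mono) (auto simp: fact_ge_1)
  then show ?thesis using binomial_le_power_div_fact[of N u] by linarith
qed

lemma support_min_cochains_subset:
  "support n (Suc j) ` min_cochains n j m \<subseteq> {F. F \<subseteq> ksimplices n j \<and> card F = m}"
  by (auto simp: min_cochains_def dest: subsetD[OF support_subset])

text \<open>A face has at most \<open>m\<close> neighbours in a support of size \<open>m\<close>, so
  the sparse bound applies to the whole support with \<open>d = m\<close>. Supports are counted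
  trivially, with at most \<open>n ^ Suc j\<close> choices for each face.\<close>

lemma small_support_bound:
  assumes p: "0 \<le> p" "p \<le> 1"
  shows "(\<Sum>\<phi>\<in>(min_cochains n j m :: (nat list \<Rightarrow> 'r::{ab_group_add,finite}) set).
      (1 - p) ^ card (support n (Suc (Suc j)) (cobdry \<phi>)))
    \<le> (real CARD('r) * real n ^ Suc j * exp (- (p * (real n - real (Suc j) - real m)))) ^ m"
    (is "_ \<le> (_ * _ * exp (- ?x)) ^ m")
proof -
  let ?M = "min_cochains n j m :: (nat list \<Rightarrow> 'r) set"
  let ?s = "support n (Suc j)"
  have b: "(1 - p) ^ card (support n (Suc (Suc j)) (cobdry \<phi>)) \<le> exp (- ?x) ^ m" if "\<phi> \<in> ?M" for \<phi>
  proof -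
    let ?b = "card (support n (Suc (Suc j)) (cobdry \<phi>))"
    have f: "skew \<phi>" "card (?s \<phi>) = m" using that by (auto simp: min_cochains_def weight_minimal_def)
    have "card (nbrs n j \<sigma> \<inter> ?s \<phi>) \<le> m" for \<sigma>
      using card_mono[of "?s \<phi>" "nbrs n j \<sigma> \<inter> ?s \<phi>"] f(2) by simp
    then have "m * (n - Suc j - m) \<le> ?b"
      using sparse_support_cobdry_lower_bound[OF f(1) subset_refl, of n j m] f(2) by simp
    then have "real m * real (n - Suc j - m) \<le> real ?b" by (metis of_nat_le_iff of_nat_mult)
    \<comment> \<open>The real difference can be negative where the truncated one is zero, so it is
      a valid lower bound.\<close>
    moreover have "real m * (real n - real (Suc j) - real m) \<le> real m * real (n - Suc j - m)"
      by (intro mult_left_mono) auto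
    ultimately have "real m * (real n - real (Suc j) - real m) \<le> real ?b" by linarith
    then have "p * (real m * (real n - real (Suc j) - real m)) \<le> p * real ?b"
      using p by (intro mult_left_mono)
    then have "exp (- (p * ?b)) \<le> exp (- (real m * ?x))" by (simp add: ac_simps)
    also have "exp (- (real m * ?x)) = exp (- ?x) ^ m" by (simp add: exp_of_nat_mult[symmetric])
    finally show ?thesis using power_one_minus_le_exp[OF p, of ?b] by (rule order_trans[rotated])
  qed
  have "card (?s ` ?M) \<le> card {F. F \<subseteq> ksimplices n j \<and> card F = m}"
    by (intro card_mono support_min_cochains_subset) simp
  also have "\<dots> = (n choose Suc j) choose m" by (simp add: n_subsets card_ksimplices)
  finally have "real (card (?s ` ?M)) \<le> real ((n choose Suc j) choose m)" by simp
  also have "\<dots> \<le> real (n choose Suc j) ^ m" by (rule binomial_le_power)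
  also have "\<dots> \<le> (real n ^ Suc j) ^ m" by (intro power_mono binomial_le_power) simp
  finally have c: "real (card (?s ` ?M)) \<le> (real n ^ Suc j) ^ m" .
  have "(\<Sum>\<phi>\<in>?M. (1 - p) ^ card (support n (Suc (Suc j)) (cobdry \<phi>))) \<le>
      real CARD('r) ^ m * (\<Sum>F\<in>?s ` ?M. exp (- ?x) ^ m)"
    using b by (intro sum_min_cochains_le) auto
  also have "\<dots> = real CARD('r) ^ m * (real (card (?s ` ?M)) * exp (- ?x) ^ m)" by simp
  also have "\<dots> \<le> real CARD('r) ^ m * ((real n ^ Suc j) ^ m * exp (- ?x) ^ m)"
    using c by (intro mult_left_mono mult_right_mono) auto
  finally show ?thesis by (simp only: power_mult_distrib mult.assoc)
qed

text \<open>Faces with more than \<open>\<epsilon> * n\<close> neighbours in \<open>F\<close> are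
  dominated by a small \<open>S\<close>, up to \<open>\<epsilon> * m\<close> exceptions; each
  remaining undominated face contributes nearly \<open>n\<close> simplices to the coboundary. Part
  of the coboundary is kept for the expansion bound, which gives the gain proportional to
  \<open>m\<close>. The set \<open>S\<close> depends on \<open>F\<close> alone, so it can encode
  \<open>F\<close>.\<close>

lemma supports_dominated:
  fixes n j :: nat and K \<epsilon> :: real
  defines "K \<equiv> real (Suc j)"
  defines "\<epsilon> \<equiv> 1 / (8 * K * (K + 1))"
  assumes F: "F \<subseteq> ksimplices n j" "card F = m" and n: "K \<le> \<epsilon> * n" "0 < n"
  shows "\<exists>S\<subseteq>ksimplices n j. card S * (\<epsilon>\<^sup>2 * n) \<le> m \<and>
    (\<forall>\<phi> :: nat list \<Rightarrow> 'r::ab_group_add. weight_minimal n (Suc j) \<phi> \<and> support n (Suc j) \<phi> = F \<longrightarrow>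
      (K - 1 / 2) * card (F - (\<Union>\<sigma>\<in>S. nbrs n j \<sigma>)) + m / (8 * (K + 1))
        \<le> K * (card (support n (Suc (Suc j)) (cobdry \<phi>)) / n))"
proof -
  have K1: "1 \<le> K" by (simp add: K_def)
  have e0: "0 < \<epsilon>" using K1 by (simp add: \<epsilon>_def)
  \<comment> \<open>The choice of \<open>\<epsilon>\<close>: the loss
    \<open>\<epsilon> * K * m\<close> from the exceptions is half of the
    \<open>m / (4 * (K + 1))\<close> gained from expansion.\<close>
  have eK: "\<epsilon> * K = 1 / (8 * (K + 1))" using K1 by (simp add: \<epsilon>_def)
  have finF: "finite F" using finite_subset[OF F(1)] by simp
  have sym: "\<sigma>' \<in> nbrs n j \<sigma> \<longleftrightarrow> \<sigma> \<in> nbrs n j \<sigma>'" if "\<sigma> \<in> F" "\<sigma>' \<in> F" for \<sigma> \<sigma>'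
    using that F(1) by (auto simp: nbrs_def Un_commute)
  define H where "H = {\<sigma> \<in> F. \<epsilon> * n < card (nbrs n j \<sigma> \<inter> F)}"
  obtain S where S: "S \<subseteq> F" "card S * (\<epsilon>\<^sup>2 * n) \<le> m"
    "card (H - (\<Union>\<sigma>\<in>S. nbrs n j \<sigma>)) * (\<epsilon> * n) \<le> m * (\<epsilon>\<^sup>2 * n)"
    using greedy_dominating_set[of F "\<epsilon>\<^sup>2 * n" "nbrs n j" "\<epsilon> * n"] finF sym e0 n(2) F(2)
    unfolding H_def by auto
  let ?\<Gamma> = "\<Union>\<sigma>\<in>S. nbrs n j \<sigma>"
  define L where "L = F - ?\<Gamma> - H"
  define u where "u = card (F - ?\<Gamma>)"
  have "card (H - ?\<Gamma>) * (\<epsilon> * n) \<le> (\<epsilon> * m) * (\<epsilon> * n)"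
    using S(3) by (simp add: power2_eq_square ac_simps)
  then have H': "card (H - ?\<Gamma>) \<le> \<epsilon> * m"
    by (rule mult_right_le_imp_le) (use e0 n in auto)
  have "card (L \<union> (H - ?\<Gamma>)) \<le> card L + card (H - ?\<Gamma>)" by (rule card_Un_le)
  moreover have "L \<union> (H - ?\<Gamma>) = F - ?\<Gamma>" by (auto simp: L_def H_def)
  ultimately have uL: "u - \<epsilon> * m \<le> card L" using H' by (simp add: u_def)
  have ineq: "(K - 1 / 2) * u + m / (8 * (K + 1)) \<le> K * (card (support n (Suc (Suc j)) (cobdry \<phi>)) / n)"
    if wm: "weight_minimal n (Suc j) \<phi>" "support n (Suc j) \<phi> = F" for \<phi> :: "nat list \<Rightarrow> 'r"
  proof -
    have sk: "skew \<phi>" using wm(1) by (simp add: weight_minimal_def)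
    define b where "b = real (card (support n (Suc (Suc j)) (cobdry \<phi>)))"
    define d where "d = nat \<lfloor>\<epsilon> * n\<rfloor>"
    have "card (nbrs n j \<sigma> \<inter> F) \<le> d" if "\<sigma> \<in> L" for \<sigma>
      using that by (auto simp: L_def H_def d_def le_nat_floor)
    then have "card L * (n - Suc j - d) \<le> card (support n (Suc (Suc j)) (cobdry \<phi>))"
      by (intro sparse_support_cobdry_lower_bound[OF sk]) (auto simp: L_def wm(2))
    then have Lb: "real (card L) * real (n - Suc j - d) \<le> b"
      unfolding b_def by (metis of_nat_le_iff of_nat_mult)
    have "real d \<le> \<epsilon> * n" using e0 by (simp add: d_def)
    \<comment> \<open>One \<open>\<epsilon> * n\<close> pays for the degree bound \<open>d\<close>,
      the other for the \<open>K\<close> vertices of the face itself.\<close>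
    then have "(1 - 2 * \<epsilon>) * n \<le> real n - K - d" using n(1) by (simp add: algebra_simps)
    also have "\<dots> \<le> real (n - Suc j - d)" by (simp add: K_def)
    finally have "real (card L) * ((1 - 2 * \<epsilon>) * n) \<le> real (card L) * real (n - Suc j - d)"
      by (intro mult_left_mono) auto
    with Lb have "real (card L) * (1 - 2 * \<epsilon>) * n \<le> b" by (simp add: mult.assoc)
    then have b1: "real (card L) * (1 - 2 * \<epsilon>) \<le> b / n" using n(2) by (simp add: field_simps)
    have "real (n * m) \<le> real (Suc (Suc j) * card (support n (Suc (Suc j)) (cobdry \<phi>)))"
      using weight_minimal_expansion[OF wm(1)] wm(2) F(2) by (simp only: of_nat_le_iff)
    then have "real n * m \<le> (K + 1) * b" by (simp add: K_def b_def algebra_simps)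
    then have b2: "m / (K + 1) \<le> b / n" using n(2) K1 by (simp add: field_simps)
    \<comment> \<open>Of the coefficient \<open>K\<close> of \<open>b / n\<close>, a quarter is
      reserved for the expansion bound, and the factor \<open>1 - 2 * \<epsilon>\<close> costs at
      most another quarter.\<close>
    have "2 * \<epsilon> * (K - 1 / 4) \<le> 2 * (\<epsilon> * K)" using e0 by (simp add: algebra_simps)
    also have "\<dots> \<le> 1 / 4" unfolding eK using K1 by (simp add: field_simps)
    finally have "K - 1 / 2 \<le> (K - 1 / 4) * (1 - 2 * \<epsilon>)" by (simp add: algebra_simps)
    then have "(K - 1 / 2) * card L \<le> (K - 1 / 4) * (1 - 2 * \<epsilon>) * card L"
      by (intro mult_right_mono) auto
    also have "\<dots> = (K - 1 / 4) * (real (card L) * (1 - 2 * \<epsilon>))" by simp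
    also have "\<dots> \<le> (K - 1 / 4) * (b / n)" using b1 K1 by (intro mult_left_mono) auto
    finally have c1: "(K - 1 / 2) * card L \<le> (K - 1 / 4) * (b / n)" .
    have "(K - 1 / 2) * u - \<epsilon> * K * m \<le> (K - 1 / 2) * (u - \<epsilon> * m)"
      using e0 by (simp add: algebra_simps)
    also have "\<dots> \<le> (K - 1 / 2) * card L" using uL K1 by (intro mult_left_mono) auto
    finally have c2: "(K - 1 / 2) * u - m / (8 * (K + 1)) \<le> (K - 1 / 2) * card L" unfolding eK by simp
    have "K * (b / n) = 1 / 4 * (b / n) + (K - 1 / 4) * (b / n)" by (simp add: algebra_simps)
    moreover have "1 / 4 * (b / n) \<ge> 1 / 4 * (m / (K + 1))" using b2 by (intro mult_left_mono) auto
    moreover have "1 / 4 * (m / (K + 1)) = 2 * (m / (8 * (K + 1)))"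
      using K1 by (simp add: field_simps)
    moreover have "x + t \<le> A" if "A = Q + B" "M \<le> Q" "M = 2 * t" "C \<le> B" "x - t \<le> C"
      for x t A Q B M C :: real using that by linarith
    ultimately have "(K - 1 / 2) * u + m / (8 * (K + 1)) \<le> K * (b / n)" using c1 c2 by blast
    then show ?thesis unfolding b_def .
  qed
  have "S \<subseteq> ksimplices n j" using S(1) F(1) by blast
  then show ?thesis using S(2) ineq unfolding u_def by blast
qed

text \<open>A family of sets F is counted through the code (S, F \<inter> N(S), F - N(S)), where S
  dominates most of F: only the last component ranges over many possibilities.\<close>

lemma sum_over_dominated_sets:
  fixes h :: "nat \<Rightarrow> real" and nb :: "'a \<Rightarrow> 'a set"
  assumes fin: "finite X" and h: "\<And>u. 0 \<le> h u"
    and nb: "\<And>x. x \<in> X \<Longrightarrow> finite (nb x) \<and> card (nb x) \<le> D"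
    and \<F>: "\<And>F. F \<in> \<F> \<Longrightarrow> F \<subseteq> X \<and> card F \<le> m \<and> S F \<subseteq> X \<and> card (S F) \<le> s"
  shows "(\<Sum>F\<in>\<F>. h (card (F - (\<Union>x\<in>S F. nb x)))) \<le>
    real (Suc (card X)) ^ s * 2 ^ (s * D) * (\<Sum>u\<le>m. real (card X choose u) * h u)"
proof -
  let ?N = "\<lambda>S. \<Union>x\<in>S. nb x"
  define P where "P = {S. S \<subseteq> X \<and> card S \<le> s}"
  define U where "U = {U. U \<subseteq> X \<and> card U \<le> m}"
  let ?C = "Sigma P (\<lambda>S. Pow (?N S) \<times> U)"
  define c where "c = (\<lambda>F. (S F, F \<inter> ?N (S F), F - ?N (S F)))"
  have finPU: "finite P" "finite U" using fin by (auto simp: P_def U_def)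
  have finN: "finite (?N T)" if "T \<in> P" for T
    using that fin nb finite_subset by (intro finite_UN_I) (auto simp: P_def)
  have inj: "inj_on c \<F>" by (rule inj_onI) (auto simp: c_def)
  have cC: "c ` \<F> \<subseteq> ?C"
  proof
    fix z assume "z \<in> c ` \<F>"
    then obtain F where F: "F \<in> \<F>" "z = c F" by blast
    have "finite F" using \<F>[OF F(1)] fin finite_subset by blast
    then have "card (F - ?N (S F)) \<le> m" using \<F>[OF F(1)] by (meson Diff_subset card_mono le_trans)
    then show "z \<in> ?C" using \<F>[OF F(1)] F(2) by (auto simp: c_def P_def U_def)
  qed
  have finC: "finite ?C" using finPU finN by auto
  have W: "(\<Sum>V\<in>U. h (card V)) = (\<Sum>u\<le>m. real (card X choose u) * h u)"
  proof -
    have "(\<Sum>V\<in>U. h (card V)) = (\<Sum>u\<le>m. \<Sum>V\<in>{V \<in> U. card V = u}. h (card V))"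
      using finPU by (intro sum.group[symmetric]) (auto simp: U_def)
    also have "\<dots> = (\<Sum>u\<le>m. real (card X choose u) * h u)"
    proof (intro sum.cong refl)
      fix u assume "u \<in> {..m}"
      then have "{V \<in> U. card V = u} = {V. V \<subseteq> X \<and> card V = u}" by (auto simp: U_def)
      then have "card {V \<in> U. card V = u} = card X choose u" by (simp add: n_subsets fin)
      then show "(\<Sum>V\<in>{V \<in> U. card V = u}. h (card V)) = real (card X choose u) * h u" by simp
    qed
    finally show ?thesis .
  qed
  let ?W = "\<Sum>u\<le>m. real (card X choose u) * h u"
  have W0: "0 \<le> ?W" using h by (intro sum_nonneg) auto
  have "(\<Sum>F\<in>\<F>. h (card (F - ?N (S F)))) = (\<Sum>z\<in>c ` \<F>. h (card (snd (snd z))))"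
    by (subst sum.reindex[OF inj]) (simp add: c_def)
  also have "\<dots> \<le> (\<Sum>z\<in>?C. h (card (snd (snd z))))"
    using cC finC h by (intro sum_mono2) auto
  also have "\<dots> = (\<Sum>T\<in>P. \<Sum>z\<in>Pow (?N T) \<times> U. h (card (snd z)))"
    using finPU finN by (subst sum.Sigma) (auto simp: case_prod_beta)
  also have "\<dots> = (\<Sum>T\<in>P. real (card (Pow (?N T))) * ?W)"
  proof (intro sum.cong refl)
    fix T
    have "(\<Sum>z\<in>Pow (?N T) \<times> U. h (card (snd z))) = (\<Sum>A\<in>Pow (?N T). \<Sum>V\<in>U. h (card V))"
      by (subst sum.cartesian_product) (simp add: case_prod_beta)
    then show "(\<Sum>z\<in>Pow (?N T) \<times> U. h (card (snd z))) = real (card (Pow (?N T))) * ?W"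
      unfolding W by simp
  qed
  also have "\<dots> \<le> (\<Sum>T\<in>P. 2 ^ (s * D) * ?W)"
  proof (intro sum_mono mult_right_mono W0)
    fix T assume T: "T \<in> P"
    then have "finite T" using fin finite_subset by (auto simp: P_def)
    then have "card (?N T) \<le> (\<Sum>x\<in>T. card (nb x))" by (rule card_UN_le)
    also have "\<dots> \<le> card T * D" using nb T by (intro sum_bounded_above[where K = D, simplified]) (auto simp: P_def)
    also have "\<dots> \<le> s * D" using T by (auto simp: P_def)
    finally have "card (Pow (?N T)) \<le> 2 ^ (s * D)" using finN[OF T] by (simp add: card_Pow)
    then show "real (card (Pow (?N T))) \<le> 2 ^ (s * D)" by (metis of_nat_le_iff of_nat_numeral of_nat_power)
  qed
  also have "\<dots> = real (card P) * (2 ^ (s * D) * ?W)" by simp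
  also have "\<dots> \<le> real (Suc (card X)) ^ s * (2 ^ (s * D) * ?W)"
  proof (intro mult_right_mono)
    have "card P \<le> Suc (card X) ^ s" unfolding P_def by (rule card_bounded_subsets_le[OF fin])
    then show "real (card P) \<le> real (Suc (card X)) ^ s" by (metis of_nat_le_iff of_nat_power)
  qed (use W0 in auto)
  finally show ?thesis by (simp add: mult.assoc)
qed

text \<open>The positive terms of the exponent pay for choosing \<open>S\<close>, for the part of
  the support dominated by \<open>S\<close>, and for the undominated rest. The negative logarithmic
  term is the gain from \<open>supports_dominated\<close> and beats them for large
  \<open>n\<close>.\<close>

lemma large_support_bound:
  fixes n j m :: nat and K \<epsilon> p :: real
  defines "K \<equiv> real (Suc j)"
  defines "\<epsilon> \<equiv> 1 / (8 * K * (K + 1))"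
  assumes p: "0 \<le> p" "p \<le> 1" "K * ln n \<le> p * n" and n: "K \<le> \<epsilon> * n" "2 \<le> n"
    and m: "sqrt n \<le> m"
  shows "(\<Sum>\<phi>\<in>(min_cochains n j m :: (nat list \<Rightarrow> 'r::{ab_group_add,finite}) set).
      (1 - p) ^ card (support n (Suc (Suc j)) (cobdry \<phi>)))
    \<le> (real CARD('r) * exp ((K + 1) * ln n / (\<epsilon>\<^sup>2 * n) + K / \<epsilon>\<^sup>2 + 2 - ln n / (8 * (K + 1)))) ^ m"
proof -
  let ?M = "min_cochains n j m :: (nat list \<Rightarrow> 'r) set"
  let ?s = "support n (Suc j)"
  let ?X = "ksimplices n j"
  let ?b = "\<lambda>\<phi> :: nat list \<Rightarrow> 'r. card (support n (Suc (Suc j)) (cobdry \<phi>))"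
  define \<F> where "\<F> = ?s ` ?M"
  define l where "l = ln (real n)"
  define N where "N = n choose Suc j"
  define c where "c = 1 / (8 * (K + 1))"
  have K1: "1 \<le> K" by (simp add: K_def)
  have e0: "0 < \<epsilon>" using K1 by (simp add: \<epsilon>_def)
  have l0: "0 \<le> l" using n by (simp add: l_def)
  have expl: "exp (real i * l) = real n ^ i" for i using n by (simp add: exp_of_nat_mult l_def)
  have "\<forall>F\<in>\<F>. \<exists>S\<subseteq>?X. card S * (\<epsilon>\<^sup>2 * n) \<le> m \<and>
    (\<forall>\<phi> :: nat list \<Rightarrow> 'r. weight_minimal n (Suc j) \<phi> \<and> ?s \<phi> = F \<longrightarrow>
      (K - 1 / 2) * card (F - (\<Union>\<sigma>\<in>S. nbrs n j \<sigma>)) + m / (8 * (K + 1)) \<le> K * (?b \<phi> / n))"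
    (is "\<forall>F\<in>\<F>. \<exists>S\<subseteq>?X. ?A S \<and> ?B F S")
  proof
    fix F assume "F \<in> \<F>"
    then have "F \<subseteq> ?X" "card F = m" using support_min_cochains_subset[of n j m] by (auto simp: \<F>_def)
    then show "\<exists>S\<subseteq>?X. ?A S \<and> ?B F S"
      unfolding \<epsilon>_def K_def
      by (rule supports_dominated) (use n in \<open>auto simp: \<epsilon>_def K_def\<close>)
  qed
  then obtain S where S: "\<And>F. F \<in> \<F> \<Longrightarrow> S F \<subseteq> ?X \<and> ?A (S F) \<and> ?B F (S F)" by metis
  let ?u = "\<lambda>F. card (F - (\<Union>\<sigma>\<in>S F. nbrs n j \<sigma>))"
  \<comment> \<open>This bound sees the cochain only through the number of undominated faces, as
    \<open>sum_over_dominated_sets\<close> requires.\<close>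
  define h where "h = (\<lambda>u::nat. exp (- (l * ((K - 1 / 2) * u + c * m))))"
  have g: "(1 - p) ^ ?b \<phi> \<le> h (?u (?s \<phi>))" if "\<phi> \<in> ?M" for \<phi>
  proof -
    have "weight_minimal n (Suc j) \<phi>" using that by (simp add: min_cochains_def)
    moreover have "?s \<phi> \<in> \<F>" using that by (simp add: \<F>_def)
    ultimately have "(K - 1 / 2) * ?u (?s \<phi>) + c * m \<le> K * (?b \<phi> / n)"
      using S[of "?s \<phi>"] by (auto simp: c_def)
    then have "l * ((K - 1 / 2) * ?u (?s \<phi>) + c * m) \<le> l * (K * (?b \<phi> / n))"
      using l0 by (rule mult_left_mono)
    also have "\<dots> = (K * l) * (?b \<phi> / n)" by simp
    \<comment> \<open>Here \<open>p\<close> being above the threshold turns the bound on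
      \<open>b / n\<close> into one on \<open>p * b\<close>.\<close>
    also have "\<dots> \<le> (p * n) * (?b \<phi> / n)" using p by (intro mult_right_mono) (auto simp: l_def)
    also have "\<dots> = p * ?b \<phi>" using n by simp
    finally have "exp (- (p * ?b \<phi>)) \<le> h (?u (?s \<phi>))" by (simp add: h_def)
    then show ?thesis using power_one_minus_le_exp[OF p(1,2), of "?b \<phi>"] by linarith
  qed
  define s where "s = nat \<lfloor>m / (\<epsilon>\<^sup>2 * n)\<rfloor>"
  have sm: "real s \<le> m / (\<epsilon>\<^sup>2 * n)" using e0 by (simp add: s_def)
  have "card (S F) \<le> s" if "F \<in> \<F>" for F
  proof -
    have "real (card (S F)) \<le> m / (\<epsilon>\<^sup>2 * n)" using S[OF that] e0 n by (simp add: field_simps)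
    then show ?thesis by (simp add: s_def le_nat_floor)
  qed
  then have sum1: "(\<Sum>F\<in>\<F>. h (?u F)) \<le>
      real (Suc (card ?X)) ^ s * 2 ^ (s * (Suc j * n)) * (\<Sum>u\<le>m. real (card ?X choose u) * h u)"
    using S support_min_cochains_subset[of n j m] card_nbrs_le
    by (intro sum_over_dominated_sets) (auto simp: h_def \<F>_def nbrs_def)
  \<comment> \<open>Choices of \<open>S\<close>: one extra factor \<open>n\<close> absorbs the
    successor, which makes the exponent \<open>K + 1\<close>.\<close>
  have f1: "real (Suc (card ?X)) ^ s \<le> exp ((K + 1) * l / (\<epsilon>\<^sup>2 * n) * m)"
  proof -
    have "real (Suc (card ?X)) \<le> real n ^ Suc j + 1"
      using binomial_le_power[of n "Suc j"] by (simp add: card_ksimplices)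
    also have "\<dots> \<le> 2 * real n ^ Suc j" using n by (simp add: one_le_power del: power_Suc)
    also have "\<dots> \<le> real n * real n ^ Suc j" using n by (intro mult_right_mono) auto
    also have "\<dots> = exp ((K + 1) * l)" using expl[of "Suc (Suc j)"] by (simp add: K_def add.commute)
    finally have "real (Suc (card ?X)) ^ s \<le> exp ((K + 1) * l) ^ s" by (intro power_mono) auto
    also have "\<dots> = exp (((K + 1) * l) * s)" by (simp add: exp_of_nat_mult[symmetric] mult.commute)
    also have "\<dots> \<le> exp (((K + 1) * l) * (m / (\<epsilon>\<^sup>2 * n)))"
      using sm K1 l0 by (simp del: times_divide_eq_right add: mult_left_mono)
    finally show ?thesis by (simp add: ac_simps)
  qed
  \<comment> \<open>Subsets of the neighbourhoods of \<open>S\<close>: since \<open>s * n\<close> is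
    at most \<open>m\<close> divided by the square of \<open>\<epsilon>\<close>, they cost only a
    constant to the power \<open>m\<close>.\<close>
  have f2: "2 ^ (s * (Suc j * n)) \<le> exp (K / \<epsilon>\<^sup>2 * m)"
  proof -
    have "(2::real) ^ (s * (Suc j * n)) \<le> exp 1 ^ (s * (Suc j * n))"
      using exp_ge_add_one_self[of 1] by (intro power_mono) auto
    also have "\<dots> = exp (s * (K * n))" by (simp add: exp_of_nat_mult[symmetric] K_def algebra_simps)
    also have "\<dots> \<le> exp (m / (\<epsilon>\<^sup>2 * n) * (K * n))"
      using sm K1 by (simp del: times_divide_eq_left add: mult_right_mono)
    also have "m / (\<epsilon>\<^sup>2 * n) * (K * n) = K / \<epsilon>\<^sup>2 * m" using n e0 by (simp add: field_simps)
    finally show ?thesis .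
  qed
  have f3: "(\<Sum>u\<le>m. real (card ?X choose u) * h u) \<le> exp ((2 - c * l) * m)"
  proof -
    have "real (card ?X choose u) * h u \<le> exp m * exp (- (c * l * m))" for u
    proof -
      have "real (card ?X choose u) \<le> real N ^ u / fact u"
        unfolding card_ksimplices N_def by (rule binomial_le_power_div_fact)
      also have "\<dots> \<le> (real n ^ Suc j) ^ u / fact u"
        unfolding N_def by (intro divide_right_mono power_mono binomial_le_power) auto
      also have "(real n ^ Suc j) ^ u = exp (K * l * u)"
        unfolding expl[symmetric] by (simp add: exp_of_nat_mult[symmetric] K_def ac_simps)
      finally have "real (card ?X choose u) * h u \<le> exp (K * l * u) / fact u * h u"
        by (intro mult_right_mono) (auto simp: h_def)
      \<comment> \<open>The \<open>n ^ (K * u)\<close> choices against the decay with exponent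
        \<open>K - 1 / 2\<close> leave \<open>sqrt n ^ u\<close>. As \<open>sqrt n \<le> m\<close>,
        this is at most \<open>m ^ u\<close>, and the factorial brings it down to
        \<open>exp m\<close>.\<close>
      also have "\<dots> = exp (l / 2 * u) / fact u * exp (- (c * l * m))"
        by (simp add: h_def exp_add[symmetric] algebra_simps)
      also have "exp (l / 2 * u) = sqrt n ^ u"
      proof -
        have "exp (l / 2) = sqrt n" using n by (simp add: l_def ln_sqrt[symmetric])
        then show ?thesis by (simp add: exp_of_nat_mult[symmetric] mult.commute flip: \<open>exp (l / 2) = sqrt n\<close>)
      qed
      also have "sqrt n ^ u / fact u * exp (- (c * l * m)) \<le> real m ^ u / fact u * exp (- (c * l * m))"
        using m by (intro mult_right_mono divide_right_mono power_mono) auto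
      also have "\<dots> \<le> exp m * exp (- (c * l * m))"
        by (intro mult_right_mono power_div_fact_le_exp) auto
      finally show ?thesis .
    qed
    then have "(\<Sum>u\<le>m. real (card ?X choose u) * h u) \<le> real (card {..m}) * (exp m * exp (- (c * l * m)))"
      by (intro sum_bounded_above) auto
    \<comment> \<open>The \<open>m + 1\<close> values of \<open>u\<close> cost a second factor
      \<open>exp m\<close>, whence the constant \<open>2\<close>.\<close>
    also have "\<dots> \<le> exp m * (exp m * exp (- (c * l * m)))"
      using exp_ge_add_one_self[of "real m"] by (intro mult_right_mono) auto
    also have "\<dots> = exp ((2 - c * l) * m)" by (simp add: exp_add[symmetric] algebra_simps)
    finally show ?thesis .
  qed
  have "(\<Sum>\<phi>\<in>?M. (1 - p) ^ ?b \<phi>) \<le> real CARD('r) ^ m * (\<Sum>F\<in>\<F>. h (?u F))"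
    unfolding \<F>_def using g by (intro sum_min_cochains_le) (auto simp: h_def)
  also have "\<dots> \<le> real CARD('r) ^ m *
      (exp ((K + 1) * l / (\<epsilon>\<^sup>2 * n) * m) * exp (K / \<epsilon>\<^sup>2 * m) * exp ((2 - c * l) * m))"
    using sum1 f1 f2 f3
    by (intro mult_left_mono order_trans[OF sum1] mult_mono) (auto simp: h_def intro!: sum_nonneg)
  also have "exp ((K + 1) * l / (\<epsilon>\<^sup>2 * n) * m) * exp (K / \<epsilon>\<^sup>2 * m) * exp ((2 - c * l) * m) =
      exp ((K + 1) * l / (\<epsilon>\<^sup>2 * n) + K / \<epsilon>\<^sup>2 + 2 - c * l) ^ m"
  proof -
    have "x * t + y * t + (2 - z) * t = t * (x + y + 2 - z)" for x y z t :: real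
      by (simp add: algebra_simps)
    then show ?thesis unfolding exp_add[symmetric] exp_of_nat_mult[symmetric] by (rule arg_cong)
  qed
  finally show ?thesis by (simp add: power_mult_distrib l_def c_def)
qed

section \<open>A geometric series and logarithmic limits\<close>

lemma geometric_sum_le:
  fixes \<rho> :: real
  assumes "0 \<le> \<rho>" "\<rho> \<le> 1 / 2"
  shows "(\<Sum>m=1..N. \<rho> ^ m) \<le> 2 * \<rho>"
proof -
  \<comment> \<open>The subtracted tail strengthens the claim enough for induction.\<close>
  have "(\<Sum>m=1..N. \<rho> ^ m) \<le> 2 * \<rho> - 2 * \<rho> * (1 / 2) ^ N"
  proof (induction N)
    case (Suc N)
    have "\<rho> ^ N \<le> (1 / 2) ^ N" using assms by (intro power_mono) auto
    then have "\<rho> ^ Suc N \<le> \<rho> * (1 / 2) ^ N" using assms by (simp add: mult_left_mono)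
    then show ?case using Suc by simp
  qed simp
  moreover have "0 \<le> 2 * \<rho> * (1 / 2) ^ N" using assms by simp
  ultimately show ?thesis by linarith
qed

lemma ln_over_sqrt_tendsto_0: "(\<lambda>n. ln (real n) / sqrt (real n)) \<longlonglongrightarrow> 0"
proof -
  have "filterlim (\<lambda>n. sqrt (real n)) at_top sequentially"
    using filterlim_compose[OF sqrt_at_top filterlim_real_sequentially] .
  then have "(\<lambda>n. ln (sqrt (real n)) / sqrt (real n)) \<longlonglongrightarrow> 0"
    by (rule filterlim_compose[OF ln_x_over_x_tendsto_0])
  then have "(\<lambda>n. 2 * (ln (sqrt (real n)) / sqrt (real n))) \<longlonglongrightarrow> 2 * 0"
    by (intro tendsto_mult tendsto_const)
  moreover have "2 * (ln (sqrt (real n)) / sqrt (real n)) = ln (real n) / sqrt (real n)" for n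
    by (cases "n = 0") (simp_all add: ln_sqrt)
  ultimately show ?thesis by (simp only: mult_zero_right)
qed

lemma ln_over_self_tendsto_0: "(\<lambda>n. ln (real n) / real n) \<longlonglongrightarrow> 0"
  using filterlim_compose[OF ln_x_over_x_tendsto_0 filterlim_real_sequentially] .

lemma eventually_ge_real: "\<forall>\<^sub>F n in sequentially. c \<le> real n"
  using filterlim_real_sequentially by (simp add: filterlim_at_top)

section \<open>The two limits\<close>

lemma tendsto_exp_diff_0:
  fixes f g :: "'a \<Rightarrow> real"
  assumes "(f \<longlongrightarrow> c) F" "filterlim g at_top F"
  shows "((\<lambda>x. exp (f x - g x)) \<longlongrightarrow> 0) F"
proof -
  have "filterlim (\<lambda>x. - f x + g x) at_top F"
    by (rule filterlim_tendsto_add_at_top[OF tendsto_minus[OF assms(1)] assms(2)])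
  then have "filterlim (\<lambda>x. - (- f x + g x)) at_bot F"
    by (rule filterlim_compose[OF filterlim_uminus_at_bot_at_top])
  then show ?thesis using filterlim_compose[OF exp_at_bot] by fastforce
qed

text \<open>Since \<open>n\<close> times the square of \<open>p\<close> tends to zero,
  \<open>(1 - p) ^ n\<close> is within a constant factor of \<open>exp (- n * p)\<close>. Hence the
  mean number of isolated faces is at least a constant times \<open>exp (\<omega> n)\<close>, and
  both terms of \<open>prob_no_isolated_le\<close> vanish in the limit.\<close>

lemma cohom_vanishes_below_threshold:
  fixes R :: "'r::ab_group_add itself" and \<omega> :: "nat \<Rightarrow> real" and j :: nat and r :: 'r
  assumes "r \<noteq> 0" and \<omega>: "filterlim \<omega> at_top sequentially"
  defines "p \<equiv> \<lambda>n. (real (Suc j) * ln n - \<omega> n) / n"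
  assumes p01: "\<forall>\<^sub>F n in sequentially. 0 \<le> p n \<and> p n \<le> 1"
  shows "(\<lambda>n. probY n (Suc j) (p n) (cohom_vanishes R n (Suc j))) \<longlonglongrightarrow> 0"
proof -
  let ?k = "Suc j"
  define K where "K = real ?k"
  have K1: "1 \<le> K" by (simp add: K_def)
  have lim1: "(\<lambda>n. K * (ln (real n) / n)) \<longlonglongrightarrow> K * 0"
    by (intro tendsto_mult tendsto_const ln_over_self_tendsto_0)
  have lim2: "(\<lambda>n. 2 * (K * (ln (real n) / sqrt n))\<^sup>2) \<longlonglongrightarrow> 2 * (K * 0)\<^sup>2"
    by (intro tendsto_mult tendsto_power tendsto_const ln_over_sqrt_tendsto_0)
  have e1: "\<forall>\<^sub>F n in sequentially. K * (ln (real n) / n) < 1 / 2"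
    by (rule order_tendstoD(2)[OF lim1]) simp
  have e2: "\<forall>\<^sub>F n in sequentially. 2 * (K * (ln (real n) / sqrt n))\<^sup>2 < 1"
    by (rule order_tendstoD(2)[OF lim2]) simp
  have e3: "\<forall>\<^sub>F n in sequentially. 0 \<le> \<omega> n" using \<omega> by (simp add: filterlim_at_top)
  have e4: "\<forall>\<^sub>F n in sequentially. ?k < n" by (rule eventually_gt_at_top)
  have bound: "\<forall>\<^sub>F n in sequentially. probY n ?k (p n) (cohom_vanishes R n ?k) \<le>
      K ^ ?k * exp (1 - \<omega> n) + 2 * K * (K * (ln (real n) / n))"
    using e1 e2 e3 e4 p01
  proof eventually_elim
    case (elim n)
    have n0: "0 < real n" using elim(4) by simp
    have pK: "p n \<le> K * (ln (real n) / n)"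
      using elim(3) n0 by (simp add: p_def K_def divide_right_mono del: of_nat_Suc)
    have ph: "0 \<le> p n" "p n \<le> 1 / 2" using elim(1,5) pK by linarith+
    have "n * (p n)\<^sup>2 \<le> n * (K * (ln (real n) / n))\<^sup>2"
      using ph pK by (intro mult_left_mono power_mono) auto
    also have "\<dots> = (K * (ln (real n) / sqrt n))\<^sup>2"
      using n0 by (simp add: power_mult_distrib power_divide power2_eq_square[of "real n"])
    \<comment> \<open>The second-order term of the logarithm is at most one; this is the
      \<open>1\<close> in \<open>exp (1 - \<omega> n)\<close>.\<close>
    finally have np2: "2 * (n * (p n)\<^sup>2) \<le> 1" using elim(2) by linarith
    have np: "n * p n = K * ln n - \<omega> n" using n0 by (simp add: p_def K_def)
    have "- p n - 2 * (p n)\<^sup>2 \<le> ln (1 - p n)" using ph by (rule ln_one_minus_pos_lower_bound)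
    then have "n * (- p n - 2 * (p n)\<^sup>2) \<le> n * ln (1 - p n)" by (intro mult_left_mono) auto
    then have "\<omega> n - 1 - K * ln n \<le> n * ln (1 - p n)" using np np2 by (simp add: algebra_simps)
    then have "exp (\<omega> n - 1 - K * ln n) \<le> exp (n * ln (1 - p n))" by simp
    also have "\<dots> = (1 - p n) ^ n" using ph by (simp add: exp_of_nat_mult)
    finally have q: "exp (\<omega> n - 1 - K * ln n) \<le> (1 - p n) ^ n" .
    have "exp (K * ln n) = real n ^ ?k" using n0 unfolding K_def by (simp only: exp_of_nat_mult exp_ln)
    then have "exp (\<omega> n - 1) / K ^ ?k = (real n / real ?k) ^ ?k * exp (\<omega> n - 1 - K * ln n)"
      by (simp add: K_def power_divide exp_diff del: of_nat_Suc power_Suc) (use n0 in \<open>simp add: field_simps\<close>)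
    also have "\<dots> \<le> real (n choose ?k) * (1 - p n) ^ n"
      using q elim(4) binomial_ge_n_over_k_pow_k[of ?k n, where 'a = real] by (intro mult_mono) auto
    finally have "1 / (real (n choose ?k) * (1 - p n) ^ n) \<le> 1 / (exp (\<omega> n - 1) / K ^ ?k)"
      using K1 ph elim(4) by (intro divide_left_mono) auto
    also have "\<dots> = K ^ ?k * exp (1 - \<omega> n)" by (simp add: exp_diff)
    finally have t1: "1 / (real (n choose ?k) * (1 - p n) ^ n) \<le> K ^ ?k * exp (1 - \<omega> n)" .
    have "probY n ?k (p n) (cohom_vanishes R n ?k) \<le>
        probY n ?k (p n) (\<lambda>S. \<forall>\<sigma>\<in>ksimplices n j. S \<inter> cofaces n j \<sigma> \<noteq> {})"
      using ph isolated_simplex_not_cohom_vanishes[OF assms(1) elim(4)] by (intro probY_mono) auto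
    also have "\<dots> \<le> 1 / (real (n choose ?k) * (1 - p n) ^ n) + 2 * real ?k * p n"
      by (rule prob_no_isolated_le[OF ph elim(4)])
    also have "\<dots> \<le> K ^ ?k * exp (1 - \<omega> n) + 2 * K * (K * (ln (real n) / n))"
      using t1 pK K1 unfolding K_def by (intro add_mono mult_left_mono) auto
    finally show ?case .
  qed
  have "(\<lambda>n. exp (1 - \<omega> n)) \<longlonglongrightarrow> 0" by (rule tendsto_exp_diff_0[OF tendsto_const \<omega>])
  then have "(\<lambda>n. K ^ ?k * exp (1 - \<omega> n) + 2 * K * (K * (ln (real n) / n))) \<longlonglongrightarrow> K ^ ?k * 0 + 2 * K * (K * 0)"
    by (intro tendsto_add tendsto_mult tendsto_const ln_over_self_tendsto_0)
  then have ub: "(\<lambda>n. K ^ ?k * exp (1 - \<omega> n) + 2 * K * (K * (ln (real n) / n))) \<longlonglongrightarrow> 0" by simp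
  show ?thesis
    by (rule tendsto_sandwich[OF _ bound tendsto_const ub])
      (use p01 in eventually_elim, simp add: probY_nonneg)
qed

text \<open>The union bound is split at \<open>m = sqrt n\<close>. On either side the terms are
  dominated by a geometric series, with ratio \<open>\<rho>\<close> for small and
  \<open>\<rho>'\<close> for large supports, and both ratios tend to zero.\<close>

lemma cohom_vanishes_above_threshold:
  fixes R :: "'r::{ab_group_add,finite} itself" and \<omega> :: "nat \<Rightarrow> real" and j :: nat
  assumes \<omega>: "filterlim \<omega> at_top sequentially"
  defines "p \<equiv> \<lambda>n. (real (Suc j) * ln n + \<omega> n) / n"
  assumes p01: "\<forall>\<^sub>F n in sequentially. 0 \<le> p n \<and> p n \<le> 1"
  shows "(\<lambda>n. probY n (Suc j) (p n) (cohom_vanishes R n (Suc j))) \<longlonglongrightarrow> 1"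
proof -
  let ?k = "Suc j"
  let ?P = "\<lambda>n. probY n ?k (p n) (\<lambda>S. \<not> cohom_vanishes R n ?k S)"
  define K where "K = real ?k"
  define \<epsilon> where "\<epsilon> = 1 / (8 * K * (K + 1))"
  define C where "C = real CARD('r)"
  \<comment> \<open>The value of \<open>K * ln n * (K + sqrt n) / n\<close>: the logarithmic part of
    what is lost in the exponent to the \<open>K + m\<close> excluded vertices.\<close>
  define a where "a = (\<lambda>n. K * (K * (ln (real n) / n) + ln (real n) / sqrt n))"
  define \<rho> where "\<rho> = (\<lambda>n. C * exp (a n - \<omega> n / 2))"
  define \<rho>' where "\<rho>' = (\<lambda>n::nat. C * exp ((K + 1) * ln n / (\<epsilon>\<^sup>2 * n) + K / \<epsilon>\<^sup>2 + 2 - ln n / (8 * (K + 1))))"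
  have K1: "1 \<le> K" by (simp add: K_def)
  have e0: "0 < \<epsilon>" using K1 by (simp add: \<epsilon>_def)
  have C1: "1 \<le> C" unfolding C_def by (simp add: Suc_le_eq card_gt_0_iff)
  have "a \<longlonglongrightarrow> K * (K * 0 + 0)"
    unfolding a_def by (intro tendsto_mult tendsto_add tendsto_const ln_over_self_tendsto_0 ln_over_sqrt_tendsto_0)
  moreover have "filterlim (\<lambda>n. 1 / 2 * \<omega> n) at_top sequentially"
    by (rule filterlim_tendsto_pos_mult_at_top[OF tendsto_const _ \<omega>]) simp
  ultimately have "(\<lambda>n. exp (a n - 1 / 2 * \<omega> n)) \<longlonglongrightarrow> 0" by (rule tendsto_exp_diff_0)
  then have "(\<lambda>n. exp (a n - \<omega> n / 2)) \<longlonglongrightarrow> 0" by simp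
  then have \<rho>0: "\<rho> \<longlonglongrightarrow> 0" unfolding \<rho>_def by (rule tendsto_mult_right_zero)
  have "(\<lambda>n. (K + 1) / \<epsilon>\<^sup>2 * (ln (real n) / n) + (K / \<epsilon>\<^sup>2 + 2)) \<longlonglongrightarrow> (K + 1) / \<epsilon>\<^sup>2 * 0 + (K / \<epsilon>\<^sup>2 + 2)"
    by (intro tendsto_mult tendsto_add tendsto_const ln_over_self_tendsto_0)
  moreover have "filterlim (\<lambda>n. 1 / (8 * (K + 1)) * ln (real n)) at_top sequentially"
    using K1 by (intro filterlim_tendsto_pos_mult_at_top[OF tendsto_const] filterlim_compose[OF ln_at_top]
        filterlim_real_sequentially) auto
  ultimately have "(\<lambda>n. exp ((K + 1) / \<epsilon>\<^sup>2 * (ln (real n) / n) + (K / \<epsilon>\<^sup>2 + 2) - 1 / (8 * (K + 1)) * ln (real n))) \<longlonglongrightarrow> 0"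
    by (rule tendsto_exp_diff_0)
  then have "(\<lambda>n. C * exp ((K + 1) / \<epsilon>\<^sup>2 * (ln (real n) / n) + (K / \<epsilon>\<^sup>2 + 2) - 1 / (8 * (K + 1)) * ln (real n))) \<longlonglongrightarrow> 0"
    by (rule tendsto_mult_right_zero)
  moreover have "(K + 1) / \<epsilon>\<^sup>2 * (ln (real n) / n) + (K / \<epsilon>\<^sup>2 + 2) - 1 / (8 * (K + 1)) * ln (real n) =
      (K + 1) * ln n / (\<epsilon>\<^sup>2 * n) + K / \<epsilon>\<^sup>2 + 2 - ln n / (8 * (K + 1))" for n by simp
  ultimately have \<rho>'0: "\<rho>' \<longlonglongrightarrow> 0" unfolding \<rho>'_def by (simp only:)
  have e1: "\<forall>\<^sub>F n in sequentially. \<rho> n < 1 / 2" by (rule order_tendstoD(2)[OF \<rho>0]) simp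
  have e2: "\<forall>\<^sub>F n in sequentially. \<rho>' n < 1 / 2" by (rule order_tendstoD(2)[OF \<rho>'0]) simp
  have e3: "\<forall>\<^sub>F n in sequentially. 0 \<le> \<omega> n" using \<omega> by (simp add: filterlim_at_top)
  have e4: "\<forall>\<^sub>F n in sequentially. 2 \<le> n" by (rule eventually_ge_at_top)
  have e5: "\<forall>\<^sub>F n in sequentially. K / \<epsilon> \<le> real n" by (rule eventually_ge_real)
  have e6: "\<forall>\<^sub>F n in sequentially. 4 * K \<le> real n" by (rule eventually_ge_real)
  have e7: "\<forall>\<^sub>F n in sequentially. 16 \<le> real n" by (rule eventually_ge_real)
  have bound: "\<forall>\<^sub>F n in sequentially. ?P n \<le> 2 * \<rho> n + 2 * \<rho>' n"
    using e1 e2 e3 e4 e5 e6 e7 p01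
  proof eventually_elim
    case (elim n)
    have n0: "0 < real n" using elim(4) by simp
    have p: "0 \<le> p n" "p n \<le> 1" using elim(8) by auto
    have np: "p n * n = K * ln n + \<omega> n" using n0 by (simp add: p_def K_def)
    have sq: "sqrt n * sqrt n = n" "4 \<le> sqrt n"
      using n0 elim(7) real_le_rsqrt[of 4 n] by auto
    let ?E = "\<lambda>m. \<Sum>\<phi>\<in>(min_cochains n j m :: (nat list \<Rightarrow> 'r) set).
       (1 - p n) ^ card (support n (Suc (Suc j)) (cobdry \<phi>))"
    have pos: "0 \<le> \<rho> n" "0 \<le> \<rho>' n" using C1 by (auto simp: \<rho>_def \<rho>'_def)
    \<comment> \<open>The sum of both bounds holds for every \<open>m\<close>, so the two geometric
      series can run over the whole range.\<close>
    have E: "?E m \<le> \<rho> n ^ m + \<rho>' n ^ m" for m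
    proof (cases "sqrt n \<le> m")
      case True
      have "?E m \<le> \<rho>' n ^ m"
        unfolding \<rho>'_def C_def \<epsilon>_def K_def
      proof (rule large_support_bound)
        show "real ?k * ln n \<le> p n * n" using np elim(3) by (simp add: K_def)
        have "K \<le> \<epsilon> * n" using elim(5) e0 by (simp add: field_simps)
        then show "real ?k \<le> 1 / (8 * real ?k * (real ?k + 1)) * n" unfolding \<epsilon>_def K_def .
      qed (use p elim True in auto)
      then show ?thesis using pos by (simp add: add_increasing)
    next
      case False
      \<comment> \<open>As \<open>\<omega>\<close> may grow at any rate compatible with
        \<open>p \<le> 1\<close>, its share of the loss is bounded relative to
        \<open>\<omega>\<close> itself: at most half of it is lost.\<close>
      have "(K + sqrt n) / n \<le> 1 / 2"
      proof -
        have "4 * sqrt n \<le> sqrt n * sqrt n" using sq(2) by (intro mult_right_mono) auto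
        then show ?thesis using elim(6) sq(1) n0 by (simp add: field_simps)
      qed
      then have "\<omega> n * ((K + sqrt n) / n) \<le> \<omega> n * (1 / 2)" using elim(3) by (intro mult_left_mono)
      moreover have "K * ln n * ((K + sqrt n) / n) = a n"
      proof -
        have "sqrt n / n = 1 / sqrt n" using sq n0 by (simp add: field_simps)
        then have "(K + sqrt n) / n = K / n + 1 / sqrt n" by (simp add: add_divide_distrib)
        then show ?thesis by (simp add: a_def algebra_simps)
      qed
      moreover have "p n * (K + sqrt n) = K * ln n * ((K + sqrt n) / n) + \<omega> n * ((K + sqrt n) / n)"
        unfolding distrib_right[symmetric] np[symmetric] using n0 by simp
      ultimately have "p n * (K + sqrt n) \<le> a n + \<omega> n / 2"
        by linarith
      moreover have "p n * (K + m) \<le> p n * (K + sqrt n)" using False p by (intro mult_left_mono) auto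
      ultimately have "K * ln n - p n * (real n - K - m) \<le> a n - \<omega> n / 2"
        using np by (simp add: algebra_simps)
      then have "exp (K * ln n - p n * (real n - K - m)) \<le> exp (a n - \<omega> n / 2)" by simp
      moreover have "exp (K * ln n) = real n ^ ?k" using n0 unfolding K_def by (simp only: exp_of_nat_mult exp_ln)
      ultimately have "real n ^ ?k * exp (- (p n * (real n - K - m))) \<le> exp (a n - \<omega> n / 2)"
        by (simp only: diff_conv_add_uminus exp_add)
      then have "C * real n ^ ?k * exp (- (p n * (real n - K - m))) \<le> \<rho> n"
        unfolding \<rho>_def using C1 by (simp only: mult.assoc) (intro mult_left_mono, auto)
      then have "(C * real n ^ ?k * exp (- (p n * (real n - K - m)))) ^ m \<le> \<rho> n ^ m"
        using C1 by (intro power_mono) auto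
      moreover have "?E m \<le> (C * real n ^ ?k * exp (- (p n * (real n - K - m)))) ^ m"
        unfolding C_def K_def by (rule small_support_bound[OF p])
      moreover have "0 \<le> \<rho>' n ^ m" using pos by simp
      ultimately show ?thesis by linarith
    qed
    have "?P n \<le> (\<Sum>m\<in>{1..n choose ?k}. ?E m)" by (rule prob_not_cohom_vanishes_le[OF p])
    also have "\<dots> \<le> (\<Sum>m\<in>{1..n choose ?k}. \<rho> n ^ m + \<rho>' n ^ m)" using E by (rule sum_mono)
    also have "\<dots> \<le> 2 * \<rho> n + 2 * \<rho>' n"
      unfolding sum.distrib using pos elim(1,2) by (intro add_mono geometric_sum_le) auto
    finally show ?case .
  qed
  have "(\<lambda>n. 2 * \<rho> n + 2 * \<rho>' n) \<longlonglongrightarrow> 2 * 0 + 2 * 0"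
    by (intro tendsto_add tendsto_mult tendsto_const \<rho>0 \<rho>'0)
  then have ub: "(\<lambda>n. 2 * \<rho> n + 2 * \<rho>' n) \<longlonglongrightarrow> 0" by simp
  have "?P \<longlonglongrightarrow> 0"
    by (rule tendsto_sandwich[OF _ bound tendsto_const ub])
      (use p01 in eventually_elim, simp add: probY_nonneg)
  then have "(\<lambda>n. 1 - ?P n) \<longlonglongrightarrow> 1 - 0" by (intro tendsto_diff tendsto_const)
  then show ?thesis by (simp add: probY_not)
qed

theorem theorem1p1:
  fixes k :: nat and \<omega> :: "nat \<Rightarrow> real" and R :: "'r::{ab_group_add, finite} itself"
  assumes "k \<ge> 1"
    and "\<exists>x::'r. x \<noteq> 0"
    and "filterlim \<omega> at_top sequentially"
  shows "((\<forall>\<^sub>F n in sequentially. 0 \<le> (k * ln n - \<omega> n) / n \<and> (k * ln n - \<omega> n) / n \<le> 1) \<longrightarrow>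
           (\<lambda>n. probY n k ((k * ln n - \<omega> n) / n) (cohom_vanishes R n k)) \<longlonglongrightarrow> 0)
       \<and> ((\<forall>\<^sub>F n in sequentially. 0 \<le> (k * ln n + \<omega> n) / n \<and> (k * ln n + \<omega> n) / n \<le> 1) \<longrightarrow>
           (\<lambda>n. probY n k ((k * ln n + \<omega> n) / n) (cohom_vanishes R n k)) \<longlonglongrightarrow> 1)"
proof -
  obtain j where k: "k = Suc j" using assms(1) by (cases k) auto
  obtain r :: 'r where "r \<noteq> 0" using assms(2) by blast
  then show ?thesis
    unfolding k
    using cohom_vanishes_below_threshold[OF _ assms(3), of r j R]
      cohom_vanishes_above_threshold[OF assms(3), of j R]
    by blast
qed

end
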